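(* Let $(\mathcal{P},\cdot,\{-,-\})$ be a complex Poisson algebra of dimension three. Then $\mathcal{P}$ has a basis $e_1,e_2,e_3$ in which it is isomorphic to one of the following Poisson algebras (only nonzero products $e_i\cdot e_j$ and $\{e_i,e_j\}$ with $i\le j$, resp. $i<j$, are listed; the rest are zero or follow from commutativity of $\cdot$ and anticommutativity of $\{-,-\}$): $\mathcal{P}_{3,1}$: all products zero; $\mathcal{P}_{3,2}$: $\{e_1,e_2\}=e_3$; $\mathcal{P}_{3,3}$: $\{e_1,e_2\}=e_2$, $\{e_1,e_3\}=e_2+e_3$; $\mathcal{P}_{3,4}^{\alpha}$ ($\alpha\in\mathbb{C}$): $\{e_1,e_2\}=e_2$, $\{e_1,e_3\}=\alpha e_3$; $\mathcal{P}_{3,5}$: $\{e_1,e_2\}=e_3$, $\{e_1,e_3\}=-2e_1$, $\{e_2,e_3\}=2e_2$; $\mathcal{P}_{3,6}$: $e_1\cdot e_1=e_2$, $e_1\cdot e_2=e_3$; $\mathcal{P}_{3,7}$: $e_1\cdot e_1=e_1$, $e_2\cdot e_2=e_2$, $e_3\cdot e_3=e_3$; $\mathcal{P}_{3,8}$: $e_1\cdot e_1=e_1$, $e_2\cdot e_2=e_2$, $e_2\cdot e_3=e_3$; $\mathcal{P}_{3,9}$: $e_1\cdot e_1=e_1$, $e_1\cdot e_2=e_2$, $e_1\cdot e_3=e_3$, $e_2\cdot e_2=e_3$; $\mathcal{P}_{3,10}$: $e_1\cdot e_1=e_1$, $e_2\cdot e_2=e_2$; $\mathcal{P}_{3,11}$: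 $e_1\cdot e_1=e_1$, $e_1\cdot e_2=e_2$; $\mathcal{P}_{3,12}$: $e_1\cdot e_1=e_1$, $e_2\cdot e_2=e_3$; $\mathcal{P}_{3,13}$: $e_1\cdot e_1=e_2$; $\mathcal{P}_{3,14}$: $e_1\cdot e_1=e_2$, $\{e_1,e_3\}=e_3$; $\mathcal{P}_{3,15}$: $e_1\cdot e_1=e_2$, $\{e_1,e_3\}=e_2$; $\mathcal{P}_{3,16}^{\alpha}$ ($\alpha\in\mathbb{C}$): $e_1\cdot e_2=e_3$, $\{e_1,e_2\}=\alpha e_3$; $\mathcal{P}_{3,17}$: $e_1\cdot e_1=e_1$, $e_1\cdot e_2=e_2$, $e_1\cdot e_3=e_3$; $\mathcal{P}_{3,18}$: $e_1\cdot e_1=e_1$, $e_1\cdot e_2=e_2$, $e_1\cdot e_3=e_3$, $\{e_2,e_3\}=e_2$; $\mathcal{P}_{3,19}$: $e_1\cdot e_1=e_1$; $\mathcal{P}_{3,20}$: $e_1\cdot e_1=e_1$, $\{e_2,e_3\}=e_2$. Between these algebras there are precisely the following isomorphisms: for $\alpha,\beta\neq 0$, $\mathcal{P}_{3,4}^{\alpha}\cong\mathcal{P}_{3,4}^{\beta}$ if and only if $\alpha=\beta$ or $\alpha=1/\beta$; and $\mathcal{P}_{3,16}^{\alpha}\cong\mathcal{P}_{3,16}^{\beta}$ if and only if $\alpha^2=\beta^2$.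
   Context: A Poisson algebra is a vector space $\mathcal{P}$ with a commutative associative product $\cdot$ and a Lie bracket $\{-,-\}$ satisfying the Leibniz identity $\{x\cdot y,z\}=\{x,z\}\cdot y+x\cdot\{y,z\}$ for all $x,y,z$. An isomorphism of Poisson algebras is a linear bijection preserving both products. *)

theory Defs
  imports Complex_Main "HOL-Library.Product_Plus"
begin

definition poisson_algebra ::
  "(complex \<Rightarrow> 'a::ab_group_add \<Rightarrow> 'a) \<Rightarrow> ('a \<Rightarrow> 'a \<Rightarrow> 'a) \<Rightarrow> ('a \<Rightarrow> 'a \<Rightarrow> 'a) \<Rightarrow> bool" where
  "poisson_algebra sc m b \<longleftrightarrow>
     vector_space sc \<and>
     (\<forall>x y z. m (x + y) z = m x z + m y z) \<and>
     (\<forall>x y z. m x (y + z) = m x y + m x z) \<and>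
     (\<forall>c x y. m (sc c x) y = sc c (m x y)) \<and>
     (\<forall>c x y. m x (sc c y) = sc c (m x y)) \<and>
     (\<forall>x y. m x y = m y x) \<and>
     (\<forall>x y z. m (m x y) z = m x (m y z)) \<and>
     (\<forall>x y z. b (x + y) z = b x z + b y z) \<and>
     (\<forall>x y z. b x (y + z) = b x y + b x z) \<and>
     (\<forall>c x y. b (sc c x) y = sc c (b x y)) \<and>
     (\<forall>c x y. b x (sc c y) = sc c (b x y)) \<and>
     (\<forall>x. b x x = 0) \<and>
     (\<forall>x y z. b x (b y z) + b y (b z x) + b z (b x y) = 0) \<and>
     (\<forall>x y z. b (m x y) z = m (b x z) y + m x (b y z))"

definition poisson_iso ::
  "(complex \<Rightarrow> 'a::ab_group_add \<Rightarrow> 'a) \<Rightarrow> ('a \<Rightarrow> 'a \<Rightarrow> 'a) \<Rightarrow> ('a \<Rightarrow> 'a \<Rightarrow> 'a) \<Rightarrow>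
   (complex \<Rightarrow> 'b::ab_group_add \<Rightarrow> 'b) \<Rightarrow> ('b \<Rightarrow> 'b \<Rightarrow> 'b) \<Rightarrow> ('b \<Rightarrow> 'b \<Rightarrow> 'b) \<Rightarrow>
   ('a \<Rightarrow> 'b) \<Rightarrow> bool" where
  "poisson_iso sc1 m1 b1 sc2 m2 b2 f \<longleftrightarrow>
     Vector_Spaces.linear sc1 sc2 f \<and> bij f \<and>
     (\<forall>x y. f (m1 x y) = m2 (f x) (f y)) \<and>
     (\<forall>x y. f (b1 x y) = b2 (f x) (f y))"

type_synonym V3 = "complex \<times> complex \<times> complex"

definition scale3 :: "complex \<Rightarrow> V3 \<Rightarrow> V3" where
  "scale3 c x = (c * fst x, c * fst (snd x), c * snd (snd x))"

definition e :: "nat \<Rightarrow> V3" where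
  "e i = (if i = 1 then (1,0,0) else if i = 2 then (0,1,0) else if i = 3 then (0,0,1) else (0,0,0))"

definition coord :: "V3 \<Rightarrow> nat \<Rightarrow> complex" where
  "coord x i = (if i = 1 then fst x else if i = 2 then fst (snd x) else if i = 3 then snd (snd x) else 0)"

text \<open>Nonzero products e_i \<cdot> e_j with i \<le> j of the algebra P_{3,n}^\<alpha>.\<close>

definition mult_list :: "nat \<Rightarrow> complex \<Rightarrow> ((nat \<times> nat) \<times> V3) list" where
  "mult_list n \<alpha> =
    (if n = 6 then [((1,1), e 2), ((1,2), e 3)]
     else if n = 7 then [((1,1), e 1), ((2,2), e 2), ((3,3), e 3)]
     else if n = 8 then [((1,1), e 1), ((2,2), e 2), ((2,3), e 3)]
     else if n = 9 then [((1,1), e 1), ((1,2), e 2), ((1,3), e 3), ((2,2), e 3)]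
     else if n = 10 then [((1,1), e 1), ((2,2), e 2)]
     else if n = 11 then [((1,1), e 1), ((1,2), e 2)]
     else if n = 12 then [((1,1), e 1), ((2,2), e 3)]
     else if n = 13 then [((1,1), e 2)]
     else if n = 14 then [((1,1), e 2)]
     else if n = 15 then [((1,1), e 2)]
     else if n = 16 then [((1,2), e 3)]
     else if n = 17 then [((1,1), e 1), ((1,2), e 2), ((1,3), e 3)]
     else if n = 18 then [((1,1), e 1), ((1,2), e 2), ((1,3), e 3)]
     else if n = 19 then [((1,1), e 1)]
     else if n = 20 then [((1,1), e 1)]
     else [])"

text \<open>Nonzero brackets {e_i, e_j} with i < j of the algebra P_{3,n}^\<alpha>.\<close>

definition br_list :: "nat \<Rightarrow> complex \<Rightarrow> ((nat \<times> nat) \<times> V3) list" where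
  "br_list n \<alpha> =
    (if n = 2 then [((1,2), e 3)]
     else if n = 3 then [((1,2), e 2), ((1,3), e 2 + e 3)]
     else if n = 4 then [((1,2), e 2), ((1,3), scale3 \<alpha> (e 3))]
     else if n = 5 then [((1,2), e 3), ((1,3), scale3 (-2) (e 1)), ((2,3), scale3 2 (e 2))]
     else if n = 14 then [((1,3), e 3)]
     else if n = 15 then [((1,3), e 2)]
     else if n = 16 then [((1,2), scale3 \<alpha> (e 3))]
     else if n = 18 then [((2,3), e 2)]
     else if n = 20 then [((2,3), e 2)]
     else [])"

definition lookup3 :: "((nat \<times> nat) \<times> V3) list \<Rightarrow> nat \<Rightarrow> nat \<Rightarrow> V3" where
  "lookup3 L i j = (case map_of L (i, j) of None \<Rightarrow> 0 | Some v \<Rightarrow> v)"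

definition mult_sc :: "nat \<Rightarrow> complex \<Rightarrow> nat \<Rightarrow> nat \<Rightarrow> V3" where
  "mult_sc n \<alpha> i j = (if i \<le> j then lookup3 (mult_list n \<alpha>) i j else lookup3 (mult_list n \<alpha>) j i)"

definition br_sc :: "nat \<Rightarrow> complex \<Rightarrow> nat \<Rightarrow> nat \<Rightarrow> V3" where
  "br_sc n \<alpha> i j = (if i < j then lookup3 (br_list n \<alpha>) i j
                     else if j < i then - lookup3 (br_list n \<alpha>) j i else 0)"

definition model_mult :: "nat \<Rightarrow> complex \<Rightarrow> V3 \<Rightarrow> V3 \<Rightarrow> V3" where
  "model_mult n \<alpha> x y =
     (\<Sum>i\<in>{1..3}. \<Sum>j\<in>{1..3}. scale3 (coord x i * coord y j) (mult_sc n \<alpha> i j))"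

definition model_br :: "nat \<Rightarrow> complex \<Rightarrow> V3 \<Rightarrow> V3 \<Rightarrow> V3" where
  "model_br n \<alpha> x y =
     (\<Sum>i\<in>{1..3}. \<Sum>j\<in>{1..3}. scale3 (coord x i * coord y j) (br_sc n \<alpha> i j))"

text \<open>When are the listed algebras P_{3,n}^\<alpha> and P_{3,m}^\<beta> claimed isomorphic.
  The parameter is only meaningful for n = 4 and n = 16.\<close>

definition listed_equiv :: "nat \<Rightarrow> complex \<Rightarrow> nat \<Rightarrow> complex \<Rightarrow> bool" where
  "listed_equiv n \<alpha> m \<beta> \<longleftrightarrow> n = m \<and>
     (n \<notin> {4, 16} \<or> \<alpha> = \<beta> \<or>
      (n = 4 \<and> \<alpha> \<noteq> 0 \<and> \<beta> \<noteq> 0 \<and> \<alpha> = 1 / \<beta>) \<or>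
      (n = 16 \<and> \<alpha>\<^sup>2 = \<beta>\<^sup>2))"

end

theory Submission
  imports Defs "HOL-Computational_Algebra.Fundamental_Theorem_Algebra"
begin

text \<open>
  Existence. An idempotent is central for the bracket, so a nonzero idempotent \<open>f\<close> splits the
  algebra into the eigenspaces \<open>1\<close> and \<open>0\<close> of multiplication by \<open>f\<close> (Peirce decomposition), and
  the cases are governed by their dimensions. If there is no nonzero idempotent, the
  Cayley-Hamilton relation \<open>x\<^sup>4 = t x\<^sup>3 - s x\<^sup>2 + d x\<close> forces \<open>x\<^sup>4 = 0\<close> for every \<open>x\<close>, and the
  associative product is one of four nilpotent ones; the Leibniz identity then leaves little
  freedom for the bracket. When the product vanishes, we have a Lie algebra: either some
  \<open>{x,y} = y \<noteq> 0\<close>, and the Jacobi identity determines the rest, or the algebra is abelian or Heisenberg.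

  Non-isomorphism. Nine existential properties that transfer along isomorphisms recover the index,
  except for the indices 3 and 4. These two and the parameters are detected by the possible ratios
  of two eigenvalues of \<open>{x,-}\<close>, and by the ratio of \<open>{x,y}\<close> to \<open>x \<cdot> y\<close> for square-zero \<open>x\<close>, \<open>y\<close>.
\<close>

section \<open>Frames and coordinates\<close>

text \<open>The algebra need not have a unit, and this decides how idempotents are produced.
  Cayley-Hamilton for multiplication by \<open>x\<close> is applied to \<open>x\<close> itself,
  which is why the relation has degree four. Dividing by its lowest nonzero coefficient yields a
  polynomial \<open>w\<close> in \<open>x\<close> without constant term such that multiplication by
  \<open>w\<close> fixes \<open>x^3\<close>; then \<open>w^3\<close> is idempotent. As
  \<open>w\<close> is a multiple of \<open>x\<close>, so is the idempotent, and it stays in every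
  ideal that contains \<open>x\<close>. This is what allows the search to be repeated inside the
  eigenspace 0. When all cubes vanish, the product is a symmetric bilinear form with values in a
  line. Its rank, 0, 1 or 2, separates the zero product, \<open>e1 e1 = e2\<close> and
  \<open>e1 e2 = e3\<close>. Algebraic closedness enters through the roots of quadratic and cubic
  polynomials and through isotropic vectors of that form. The identification of \<alpha> with
  1/\<alpha> comes from the freedom to choose which of two eigenvalues is normalised to 1.\<close>

definition comb :: "(complex \<Rightarrow> 'a::ab_group_add \<Rightarrow> 'a) \<Rightarrow> 'a \<Rightarrow> 'a \<Rightarrow> 'a \<Rightarrow> V3 \<Rightarrow> 'a" where
  "comb sc u v w p = sc (fst p) u + sc (fst (snd p)) v + sc (snd (snd p)) w"

text \<open>A basis, encoded as bijectivity of its coordinate map: the inverse of this map is then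
  the isomorphism used in \<open>transport\<close>.\<close>

definition frame :: "(complex \<Rightarrow> 'a::ab_group_add \<Rightarrow> 'a) \<Rightarrow> 'a \<Rightarrow> 'a \<Rightarrow> 'a \<Rightarrow> bool" where
  "frame sc u v w \<longleftrightarrow> bij (comb sc u v w)"

definition classified ::
  "(complex \<Rightarrow> 'a::ab_group_add \<Rightarrow> 'a) \<Rightarrow> ('a \<Rightarrow> 'a \<Rightarrow> 'a) \<Rightarrow> ('a \<Rightarrow> 'a \<Rightarrow> 'a) \<Rightarrow> bool" where
  "classified sc m b \<longleftrightarrow> (\<exists>n \<alpha> f. n \<in> {1..20} \<and>
     poisson_iso sc m b scale3 (model_mult n \<alpha>) (model_br n \<alpha>) f)"

definition det3 :: "V3 \<Rightarrow> V3 \<Rightarrow> V3 \<Rightarrow> complex" where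
  "det3 u v w = (case (u, v, w) of ((a1,a2,a3),(b1,b2,b3),(c1,c2,c3)) \<Rightarrow>
     a1 * (b2 * c3 - b3 * c2) - a2 * (b1 * c3 - b3 * c1) + a3 * (b1 * c2 - b2 * c1))"

lemma scale3_triple [simp]: "scale3 c (x, y, z) = (c * x, c * y, c * z)"
  by (simp add: scale3_def)

lemma comb3_triple [simp]:
  "comb scale3 (a1,a2,a3) (b1,b2,b3) (c1,c2,c3) (x, y, z) =
     (x * a1 + y * b1 + z * c1, x * a2 + y * b2 + z * c2, x * a3 + y * b3 + z * c3)"
  by (simp add: comb_def)

lemma det3_triple [simp]:
  "det3 (a1,a2,a3) (b1,b2,b3) (c1,c2,c3) =
     a1 * (b2 * c3 - b3 * c2) - a2 * (b1 * c3 - b3 * c1) + a3 * (b1 * c2 - b2 * c1)"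
  by (simp add: det3_def)

lemma zero3: "(0 :: V3) = (0, 0, 0)"
  by (simp add: zero_prod_def)

lemma vector_space_scale3: "vector_space scale3"
  by unfold_locales (auto simp: algebra_simps)

lemma scale3_eq_0: "scale3 c x = 0 \<longleftrightarrow> c = 0 \<or> x = 0"
  using vector_space.scale_eq_0_iff [OF vector_space_scale3] .

lemma scale3_zero [simp]: "scale3 0 x = 0" "scale3 c 0 = 0"
  by (simp_all add: scale3_eq_0)

lemma double_eq_0: "x + x = 0 \<longleftrightarrow> x = (0 :: V3)"
  by (cases x) (auto simp: zero3)

lemma scale3_solve:
  assumes "scale3 p u + scale3 c v = 0" "c \<noteq> 0"
  shows "v = scale3 (- p / c) u"
  using assms by (cases u; cases v) (simp add: zero3 eq_neg_iff_add_eq_0 field_simps)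

lemma model_mult_triple:
  "model_mult n \<alpha> (x1,x2,x3) (y1,y2,y3) =
     scale3 (x1 * y1) (mult_sc n \<alpha> 1 1) + scale3 (x1 * y2 + x2 * y1) (mult_sc n \<alpha> 1 2)
     + scale3 (x1 * y3 + x3 * y1) (mult_sc n \<alpha> 1 3) + scale3 (x2 * y2) (mult_sc n \<alpha> 2 2)
     + scale3 (x2 * y3 + x3 * y2) (mult_sc n \<alpha> 2 3) + scale3 (x3 * y3) (mult_sc n \<alpha> 3 3)"
proof -
  interpret vector_space scale3 by (rule vector_space_scale3)
  have s: "{1..3} = {1, 2, 3::nat}" by auto
  show ?thesis
    unfolding model_mult_def s
    by (simp add: coord_def mult_sc_def scale_left_distrib add_ac)
qed

lemma model_br_triple:
  "model_br n \<alpha> (x1,x2,x3) (y1,y2,y3) =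
     scale3 (x1 * y2 - x2 * y1) (br_sc n \<alpha> 1 2) + scale3 (x1 * y3 - x3 * y1) (br_sc n \<alpha> 1 3)
     + scale3 (x2 * y3 - x3 * y2) (br_sc n \<alpha> 2 3)"
proof -
  interpret vector_space scale3 by (rule vector_space_scale3)
  have s: "{1..3} = {1, 2, 3::nat}" by auto
  show ?thesis
    unfolding model_br_def s
    by (simp add: coord_def br_sc_def scale_left_diff_distrib scale_right_diff_distrib algebra_simps)
qed

lemmas model_table = mult_sc_def br_sc_def lookup3_def mult_list_def br_list_def e_def zero3

lemmas model_simps = model_mult_triple model_br_triple model_table

section \<open>Determinants as a test of linear independence\<close>

lemma frame_det3:
  assumes "det3 u v w \<noteq> 0"
  shows "frame scale3 u v w"
proof -
  obtain a1 a2 a3 b1 b2 b3 c1 c2 c3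
    where u: "u = (a1,a2,a3)" and v: "v = (b1,b2,b3)" and w: "w = (c1,c2,c3)"
    by (metis prod_cases3)
  define d where "d = det3 u v w"
  \<comment> \<open>Cramer's rule.\<close>
  define g where "g = (\<lambda>p::V3. (det3 p v w / d, det3 u p w / d, det3 u v p / d))"
  have d: "d \<noteq> 0" "d = a1 * (b2 * c3 - b3 * c2) - a2 * (b1 * c3 - b3 * c1) + a3 * (b1 * c2 - b2 * c1)"
    using assms by (simp_all add: d_def u v w)
  have 1: "g (comb scale3 u v w p) = p" for p
  proof -
    obtain x y z where p: "p = (x, y, z)" by (metis prod_cases3)
    have "det3 (comb scale3 u v w p) v w = x * d"
      by (simp add: u v w p d) algebra
    moreover have "det3 u (comb scale3 u v w p) w = y * d"
      by (simp add: u v w p d) algebra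
    moreover have "det3 u v (comb scale3 u v w p) = z * d"
      by (simp add: u v w p d) algebra
    ultimately show ?thesis using d(1) by (simp add: g_def p)
  qed
  have 2: "comb scale3 u v w (g p) = p" for p
  proof -
    obtain x y z where p: "p = (x, y, z)" by (metis prod_cases3)
    have *: "(r * s / d + r' * s' / d + r'' * s'' / d = t) \<longleftrightarrow> r * s + r' * s' + r'' * s'' = t * d"
      for r s r' s' r'' s'' t
      using d(1) by (simp add: field_simps)
    have "det3 p v w * a1 + det3 u p w * b1 + det3 u v p * c1 = x * d"
      "det3 p v w * a2 + det3 u p w * b2 + det3 u v p * c2 = y * d"
      "det3 p v w * a3 + det3 u p w * b3 + det3 u v p * c3 = z * d"
      by (simp add: u v w p d, algebra)+
    then show ?thesis using d(1)
      by (simp add: comb_def g_def u v w p add_divide_distrib [symmetric])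
  qed
  show ?thesis unfolding frame_def
    by (rule o_bij [of g]) (auto simp: 1 2)
qed

lemma det3_multilinear:
  "det3 u (v + v') w = det3 u v w + det3 u v' w"
  "det3 u v (w + w') = det3 u v w + det3 u v w'"
  by (cases u; cases v; cases v'; cases w; cases w'; simp add: algebra_simps)+

text \<open>If some cofactor does not vanish, the cofactors along a column are the coefficients of a
  relation. Otherwise all minors of size two vanish, and \<open>u\<close> and \<open>v\<close> are
  proportional.\<close>

lemma det3_eq_0_dependent:
  assumes "det3 u v w = 0"
  obtains a b c where "(a, b, c) \<noteq> (0, 0, 0)" "scale3 a u + scale3 b v + scale3 c w = 0"
proof -
  obtain a1 a2 a3 b1 b2 b3 c1 c2 c3
    where u: "u = (a1,a2,a3)" and v: "v = (b1,b2,b3)" and w: "w = (c1,c2,c3)"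
    by (metis prod_cases3)
  have d: "a1 * (b2 * c3 - b3 * c2) - a2 * (b1 * c3 - b3 * c1) + a3 * (b1 * c2 - b2 * c1) = 0"
    using assms by (simp add: u v w)
  note witness = that
  have try_coeffs: thesis if "(a, b, c) \<noteq> (0, 0, 0)"
      "a * a1 + b * b1 + c * c1 = 0" "a * a2 + b * b2 + c * c2 = 0" "a * a3 + b * b3 + c * c3 = 0" for a b c
    using that by (intro witness [of a b c]) (simp_all add: u v w zero3)
  show thesis
  proof (cases "(b2*c3-b3*c2, a3*c2-a2*c3, a2*b3-a3*b2) = (0,0,0)
      \<and> (b1*c3-b3*c1, a3*c1-a1*c3, a1*b3-a3*b1) = (0,0,0)
      \<and> (b1*c2-b2*c1, a2*c1-a1*c2, a1*b2-a2*b1) = (0,0,0)")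
    case False
    then consider "(b2*c3-b3*c2, a3*c2-a2*c3, a2*b3-a3*b2) \<noteq> (0,0,0)"
      | "(b1*c3-b3*c1, a3*c1-a1*c3, a1*b3-a3*b1) \<noteq> (0,0,0)"
      | "(b1*c2-b2*c1, a2*c1-a1*c2, a1*b2-a2*b1) \<noteq> (0,0,0)" by blast
    then show ?thesis
      by cases (erule try_coeffs; use d in \<open>simp add: algebra_simps\<close>)+
  next
    case True
    then have z: "b2*c3-b3*c2 = 0" "a3*c2-a2*c3 = 0" "a2*b3-a3*b2 = 0" "b1*c3-b3*c1 = 0"
      "a3*c1-a1*c3 = 0" "a1*b3-a3*b1 = 0" "b1*c2-b2*c1 = 0" "a2*c1-a1*c2 = 0" "a1*b2-a2*b1 = 0"
      by auto
    show ?thesis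
    proof (cases "u = 0")
      case True
      then show ?thesis by (intro try_coeffs [of 1 0 0]) (simp_all add: u zero3)
    next
      case False
      then have "(b1, - a1, 0) \<noteq> (0,0,0) \<or> (b2, - a2, 0) \<noteq> (0,0,0) \<or> (b3, - a3, 0) \<noteq> (0,0,0::complex)"
        by (auto simp: u zero3)
      then show ?thesis
        by (elim disjE) (erule try_coeffs; use z in \<open>simp add: algebra_simps\<close>)+
    qed
  qed
qed

text \<open>The determinants with the three unit vectors are the coordinates of the cross product of
  \<open>u\<close> and \<open>v\<close>; if they all vanish, \<open>u\<close> and \<open>v\<close>
  are proportional.\<close>

lemma det3_extend2:
  assumes "\<And>a b. scale3 a u + scale3 b v = 0 \<Longrightarrow> a = 0 \<and> b = 0"
  obtains w where "det3 u v w \<noteq> 0"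
proof -
  obtain a1 a2 a3 b1 b2 b3
    where u: "u = (a1,a2,a3)" and v: "v = (b1,b2,b3)"
    by (metis prod_cases3)
  show thesis
  proof (rule ccontr)
    assume "\<not> thesis"
    then have 0: "det3 u v w = 0" for w using that by blast
    have z: "a2*b3-a3*b2 = 0" "a3*b1-a1*b3 = 0" "a1*b2-a2*b1 = 0"
      using 0 [of "(1,0,0)"] 0 [of "(0,1,0)"] 0 [of "(0,0,1)"] by (simp_all add: u v)
    have "a1 = 0" using assms [of b1 "- a1"] z by (simp add: u v zero3 algebra_simps)
    moreover have "a2 = 0" using assms [of b2 "- a2"] z by (simp add: u v zero3 algebra_simps)
    moreover have "a3 = 0" using assms [of b3 "- a3"] z by (simp add: u v zero3 algebra_simps)
    ultimately show False using assms [of 1 0] by (simp add: u v zero3)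
  qed
qed

lemma det3_extend1:
  assumes "u \<noteq> 0"
  obtains v w where "det3 u v w \<noteq> 0"
proof -
  obtain a1 a2 a3 where u: "u = (a1,a2,a3)"  by (metis prod_cases3)
  show thesis
    using assms that [of "(0,1,0)" "(0,0,1)"] that [of "(0,0,1)" "(1,0,0)"] that [of "(1,0,0)" "(0,1,0)"]
    by (auto simp: u zero3)
qed

lemma det3_span:
  assumes "det3 u v w \<noteq> 0"
  obtains a b c where "x = scale3 a u + scale3 b v + scale3 c w"
  using frame_det3 [OF assms] that unfolding frame_def comb_def bij_def surj_def by metis

lemma det3_swap: "det3 u v w = - det3 u w v"
  by (cases u; cases v; cases w) (simp add: algebra_simps)

lemma det3_shear: "det3 (u + v) v w = - det3 v u w"
  by (cases u; cases v; cases w) (simp add: algebra_simps)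

lemma frame_exists:
  fixes sc :: "complex \<Rightarrow> 'a::ab_group_add \<Rightarrow> 'a"
  assumes "vector_space sc" and "vector_space.dim sc (UNIV :: 'a set) = 3"
  obtains u v w :: 'a where "frame sc u v w"
proof -
  interpret vector_space sc by fact
  obtain S :: "'a set" where S: "independent S" "UNIV \<subseteq> span S" "card S = 3"
    using basis_exists [of "UNIV :: 'a set"] assms(2) by metis
  obtain u v w where S3: "S = {u, v, w}" "u \<noteq> v" "u \<noteq> w" "v \<noteq> w"
    using S(3) by (auto simp: card_3_iff)
  have "inj (comb sc u v w)"
  proof (rule injI)
    fix p q assume eq: "comb sc u v w p = comb sc u v w q"
    define c where "c = (\<lambda>x. if x = u then fst p - fst q else if x = v then fst (snd p) - fst (snd q)
      else snd (snd p) - snd (snd q))"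
    have "(\<Sum>x\<in>S. sc (c x) x) = 0"
      using eq S3 by (simp add: c_def comb_def scale_left_diff_distrib algebra_simps)
    then have "\<forall>x\<in>S. c x = 0"
      using S(1) S3 by (auto simp: dependent_finite)
    then show "p = q" using S3 by (auto simp: c_def prod_eq_iff)
  qed
  moreover have "surj (comb sc u v w)"
  unfolding surj_def
  proof
    fix y show "\<exists>x. y = comb sc u v w x"
    proof -
      have "y \<in> span {u, v, w}" using S(2) S3 by auto
      then obtain a b c where "y = sc a u + sc b v + sc c w"
        by (force simp: span_breakdown_eq algebra_simps)
      then show ?thesis by (intro exI [of _ "(a,b,c)"]) (simp add: comb_def)
    qed
  qed
  ultimately show thesis using that by (auto simp: frame_def bij_def)
qed

section \<open>Composition, inversion and transport along isomorphisms\<close>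

lemma poisson_iso_compose:
  assumes "poisson_iso sc1 m1 b1 sc2 m2 b2 f" "poisson_iso sc2 m2 b2 sc3 m3 b3 g"
  shows "poisson_iso sc1 m1 b1 sc3 m3 b3 (g \<circ> f)"
  using assms unfolding poisson_iso_def
  by (auto intro: bij_comp Vector_Spaces.linear_compose)

lemma classified_trans:
  assumes "poisson_iso sc1 m1 b1 sc2 m2 b2 f" "classified sc2 m2 b2"
  shows "classified sc1 m1 b1"
  using assms poisson_iso_compose unfolding classified_def by blast

lemma poisson_iso_sym:
  assumes "poisson_iso sc1 m1 b1 sc2 m2 b2 f"
  shows "poisson_iso sc2 m2 b2 sc1 m1 b1 (inv f)"
proof -
  have f: "Vector_Spaces.linear sc1 sc2 f" "bij f" "\<And>x y. f (m1 x y) = m2 (f x) (f y)"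
    "\<And>x y. f (b1 x y) = b2 (f x) (f y)"
    using assms by (auto simp: poisson_iso_def)
  interpret Vector_Spaces.linear sc1 sc2 f by fact
  have i: "f (inv f y) = y" "inv f (f x) = x" for x y
    using f(2) by (simp_all add: bij_is_surj surj_f_inv_f bij_is_inj)
  have "Vector_Spaces.linear sc2 sc1 (inv f)"
    using f(2) by unfold_locales (metis add i scale)+
  moreover have "bij (inv f)" using f(2) by (rule bij_imp_bij_inv)
  ultimately show ?thesis unfolding poisson_iso_def by (metis f(3,4) i)
qed

text \<open>The images of the frame vectors are recorded so that structure constants can be read off
  after the move to \<open>V3\<close>.\<close>

lemma transport:
  assumes P: "poisson_algebra sc m b" and fr: "frame sc u v w"
  obtains m' b' g where "poisson_algebra scale3 m' b'" "poisson_iso sc m b scale3 m' b' g"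
    "g u = (1,0,0)" "g v = (0,1,0)" "g w = (0,0,1)"
proof -
  interpret vector_space sc using P by (simp add: poisson_algebra_def)
  define h where "h = comb sc u v w"
  define g where "g = inv h"
  have bij: "bij h" using fr by (simp add: frame_def h_def)
  have hg [simp]: "h (g x) = x" for x
    using bij by (simp add: g_def bij_is_surj surj_f_inv_f)
  have gh [simp]: "g (h x) = x" for x
    using bij by (simp add: g_def bij_is_inj)
  have hadd: "h (x + y) = h x + h y" for x y
    by (simp add: h_def comb_def scale_left_distrib algebra_simps)
  have hsc: "h (scale3 c x) = sc c (h x)" for c x
    by (simp add: h_def comb_def scale3_def scale_right_distrib)
  have gadd: "g (x + y) = g x + g y" for x y
    by (metis gh hg hadd)
  have gsc: "g (sc c x) = scale3 c (g x)" for c x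
    by (metis gh hg hsc)
  have g0: "g 0 = 0" using gadd [of 0 0] by simp
  define m' where "m' = (\<lambda>x y. g (m (h x) (h y)))"
  define b' where "b' = (\<lambda>x y. g (b (h x) (h y)))"
  have "poisson_algebra scale3 m' b'"
    using P unfolding poisson_algebra_def m'_def b'_def
    by (auto simp: hadd hsc gadd [symmetric] gsc [symmetric] g0 vector_space_scale3)
  moreover have "Vector_Spaces.linear sc scale3 g"
    using vector_space_scale3 vector_space_axioms gadd gsc
    by (simp add: linear_iff_module_hom module_hom_iff vector_space_def module_def linear_def)
  then have "poisson_iso sc m b scale3 m' b' g"
    using bij_imp_bij_inv [OF bij] by (simp add: poisson_iso_def m'_def b'_def g_def [symmetric])
  moreover have "h (1,0,0) = u" "h (0,1,0) = v" "h (0,0,1) = w"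
    by (simp_all add: h_def comb_def)
  then have "g u = (1,0,0)" "g v = (0,1,0)" "g w = (0,0,1)"
    using gh by metis+
  ultimately show thesis using that by blast
qed

section \<open>Roots of quadratic and cubic polynomials in Vieta's form\<close>

lemma quadratic_split:
  obtains r s :: complex where "r + s = p" "r * s = q"
proof
  let ?d = "csqrt (p\<^sup>2 - 4 * q)"
  show "(p + ?d) / 2 + (p - ?d) / 2 = p" by (simp add: field_simps)
  have "?d * ?d = p * p - 4 * q" by (metis power2_csqrt power2_eq_square)
  then show "(p + ?d) / 2 * ((p - ?d) / 2) = q" by (simp add: field_simps)
qed

lemma cubic_split:
  obtains l m n :: complex where "l + m + n = t" "l * m + l * n + m * n = s" "l * m * n = d"
proof -
  have "\<not> constant (poly [:- d, s, - t, 1:])"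
    by (simp add: constant_degree)
  then obtain l where "poly [:- d, s, - t, 1:] l = 0"
    using fundamental_theorem_of_algebra by blast
  then have l: "d = l * (s - l * (t - l))" by (simp add: algebra_simps)
  \<comment> \<open>\<open>m\<close> and \<open>n\<close> are the roots of the quotient of the cubic
    by \<open>X - l\<close>.\<close>
  obtain m n where mn: "m + n = t - l" "m * n = s - l * (t - l)"
    by (rule quadratic_split)
  have "l * m + l * n + m * n = l * (m + n) + m * n" by (simp add: algebra_simps)
  then have "l * m + l * n + m * n = s" by (simp add: mn)
  moreover have "l * m * n = d" using l mn by (simp add: mult.assoc)
  moreover have "l + m + n = t" using mn(1) by (simp add: algebra_simps)
  ultimately show thesis using that by blast
qed

section \<open>Poisson algebras in coordinates\<close>

locale poisson3 =
  fixes M B :: "V3 \<Rightarrow> V3 \<Rightarrow> V3"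
  assumes poisson: "poisson_algebra scale3 M B"
begin

lemma M_add: "M (x + y) z = M x z + M y z" "M x (y + z) = M x y + M x z"
  and M_scale: "M (scale3 c x) y = scale3 c (M x y)" "M x (scale3 c y) = scale3 c (M x y)"
  and M_comm: "M x y = M y x"
  and M_assoc: "M (M x y) z = M x (M y z)"
  and B_add: "B (x + y) z = B x z + B y z" "B x (y + z) = B x y + B x z"
  and B_scale: "B (scale3 c x) y = scale3 c (B x y)" "B x (scale3 c y) = scale3 c (B x y)"
  and B_self: "B x x = 0"
  and B_Jacobi: "B x (B y z) + B y (B z x) + B z (B x y) = 0"
  and B_Leibniz: "B (M x y) z = M (B x z) y + M x (B y z)"
  using poisson unfolding poisson_algebra_def by - metis+

lemma B_anti: "B y x = - B x y"
proof -
  have "B (x + y) (x + y) = 0" by (rule B_self)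
  then have "B x y + B y x = 0" by (simp only: B_add) (simp add: B_self add.commute)
  then show ?thesis by (simp add: eq_neg_iff_add_eq_0 add.commute)
qed

lemma M_zero [simp]: "M 0 x = 0" "M x 0 = 0"
  using M_add(1) [of 0 0 x] M_add(2) [of x 0 0] by simp_all

lemma B_zero [simp]: "B 0 x = 0" "B x 0 = 0"
  using B_add(1) [of 0 0 x] B_add(2) [of x 0 0] by simp_all

definition "M11 = M (1,0,0) (1,0,0)"
definition "M12 = M (1,0,0) (0,1,0)"
definition "M13 = M (1,0,0) (0,0,1)"
definition "M22 = M (0,1,0) (0,1,0)"
definition "M23 = M (0,1,0) (0,0,1)"
definition "M33 = M (0,0,1) (0,0,1)"
definition "B12 = B (1,0,0) (0,1,0)"
definition "B13 = B (1,0,0) (0,0,1)"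
definition "B23 = B (0,1,0) (0,0,1)"

lemma triple_expand: "(x, y, z) = scale3 x (1,0,0) + (scale3 y (0,1,0) + scale3 z (0,0,1))"
  by simp

lemma M_expand: "M (x1,x2,x3) (y1,y2,y3) =
    scale3 (x1 * y1) M11 + scale3 (x1 * y2 + x2 * y1) M12 + scale3 (x1 * y3 + x3 * y1) M13
    + scale3 (x2 * y2) M22 + scale3 (x2 * y3 + x3 * y2) M23 + scale3 (x3 * y3) M33"
proof -
  interpret vector_space scale3 by (rule vector_space_scale3)
  have sym: "M (0,1,0) (1,0,0) = M12" "M (0,0,1) (1,0,0) = M13" "M (0,0,1) (0,1,0) = M23"
    unfolding M12_def M13_def M23_def by (simp_all only: M_comm)
  show ?thesis
    unfolding triple_expand [of x1 x2 x3] triple_expand [of y1 y2 y3]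
    by (simp only: M_add M_scale sym M11_def [symmetric] M12_def [symmetric] M13_def [symmetric]
      M22_def [symmetric] M23_def [symmetric] M33_def [symmetric]
      scale_right_distrib scale_left_distrib scale_scale mult.commute add_ac)
qed

lemma B_expand: "B (x1,x2,x3) (y1,y2,y3) =
    scale3 (x1 * y2 - x2 * y1) B12 + scale3 (x1 * y3 - x3 * y1) B13 + scale3 (x2 * y3 - x3 * y2) B23"
proof -
  interpret vector_space scale3 by (rule vector_space_scale3)
  have sym: "B (0,1,0) (1,0,0) = - B12" "B (0,0,1) (1,0,0) = - B13" "B (0,0,1) (0,1,0) = - B23"
    unfolding B12_def B13_def B23_def by (simp_all only: B_anti [symmetric])
  show ?thesis
    unfolding triple_expand [of x1 x2 x3] triple_expand [of y1 y2 y3]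
    unfolding B_add B_scale B_self sym B12_def [symmetric] B13_def [symmetric] B23_def [symmetric]
    by (simp add: scale_right_distrib scale_left_diff_distrib scale_scale algebra_simps)
qed

text \<open>Normal forms are reached by choosing adapted vectors and reading off their products: the
  new structure constants are the \<open>g\<close>-images of products computed in the old
  algebra.\<close>

lemma change_basis:
  assumes "det3 u v w \<noteq> 0"
  obtains M' B' g where "poisson3 M' B'" "poisson_iso scale3 M B scale3 M' B' g"
    "\<And>x y. g (x + y) = g x + g y" "\<And>x y. g (x - y) = g x - g y" "\<And>c x. g (scale3 c x) = scale3 c (g x)" "\<And>x. g x = 0 \<longleftrightarrow> x = 0"
    "\<And>x y. M' (g x) (g y) = g (M x y)" "\<And>x y. B' (g x) (g y) = g (B x y)"
    "g u = (1,0,0)" "g v = (0,1,0)" "g w = (0,0,1)" "surj g"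
    "poisson3.M11 M' = g (M u u)" "poisson3.M12 M' = g (M u v)" "poisson3.M13 M' = g (M u w)"
    "poisson3.M22 M' = g (M v v)" "poisson3.M23 M' = g (M v w)" "poisson3.M33 M' = g (M w w)"
    "poisson3.B12 B' = g (B u v)" "poisson3.B13 B' = g (B u w)" "poisson3.B23 B' = g (B v w)"
proof -
  obtain M' B' g where T: "poisson_algebra scale3 M' B'" "poisson_iso scale3 M B scale3 M' B' g"
    "g u = (1,0,0)" "g v = (0,1,0)" "g w = (0,0,1)"
    using transport [OF poisson frame_det3 [OF assms]] by metis
  interpret T: poisson3 M' B' by unfold_locales (rule T(1))
  have g: "Vector_Spaces.linear scale3 scale3 g" "bij g"
    "g (M x y) = M' (g x) (g y)" "g (B x y) = B' (g x) (g y)" for x y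
    using T(2) unfolding poisson_iso_def by - blast+
  interpret g: Vector_Spaces.linear scale3 scale3 g by (rule g(1))
  have "g x = 0 \<longleftrightarrow> x = 0" for x
    using g(2) g.zero by (metis bij_pointE)
  then show thesis
    using T g
    by (intro that [of M' B' g]) (simp_all add: T.poisson3_axioms g.add g.scale g.diff bij_is_surj
       T.M11_def T.M12_def T.M13_def T.M22_def T.M23_def T.M33_def T.B12_def T.B13_def T.B23_def)
qed

text \<open>By bilinearity and symmetry, respectively antisymmetry, nine products of basis vectors
  determine both operations, so exhibiting a basis with the right table is enough.\<close>

lemma classifiedI:
  assumes "n \<in> {1..20}" "det3 u v w \<noteq> 0"
    and "M u u = comb scale3 u v w (mult_sc n \<alpha> 1 1)" "M u v = comb scale3 u v w (mult_sc n \<alpha> 1 2)"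
    "M u w = comb scale3 u v w (mult_sc n \<alpha> 1 3)" "M v v = comb scale3 u v w (mult_sc n \<alpha> 2 2)"
    "M v w = comb scale3 u v w (mult_sc n \<alpha> 2 3)" "M w w = comb scale3 u v w (mult_sc n \<alpha> 3 3)"
    "B u v = comb scale3 u v w (br_sc n \<alpha> 1 2)" "B u w = comb scale3 u v w (br_sc n \<alpha> 1 3)"
    "B v w = comb scale3 u v w (br_sc n \<alpha> 2 3)"
  shows "classified scale3 M B"
  using assms(2)
proof (rule change_basis)
  fix M' B' g
  assume T: "poisson3 M' B'" "poisson_iso scale3 M B scale3 M' B' g"
    "\<And>x y. g (x + y) = g x + g y" "\<And>c x. g (scale3 c x) = scale3 c (g x)"
    "g u = (1,0,0)" "g v = (0,1,0)" "g w = (0,0,1)"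
    and C: "poisson3.M11 M' = g (M u u)" "poisson3.M12 M' = g (M u v)" "poisson3.M13 M' = g (M u w)"
    "poisson3.M22 M' = g (M v v)" "poisson3.M23 M' = g (M v w)" "poisson3.M33 M' = g (M w w)"
    "poisson3.B12 B' = g (B u v)" "poisson3.B13 B' = g (B u w)" "poisson3.B23 B' = g (B v w)"
  interpret T: poisson3 M' B' by (rule T(1))
  have g: "g (comb scale3 u v w p) = p" for p
    by (cases p) (simp add: T comb_def)
  have "M' x y = model_mult n \<alpha> x y" for x y
    by (cases x; cases y) (simp only: T.M_expand model_mult_triple C assms g)
  moreover have "B' x y = model_br n \<alpha> x y" for x y
    by (cases x; cases y) (simp only: T.B_expand model_br_triple C assms g)
  ultimately have "M' = model_mult n \<alpha>" "B' = model_br n \<alpha>" by blast+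
  then show ?thesis using T(2) assms(1) unfolding classified_def by blast
qed

subsection \<open>Algebras with a nonzero idempotent\<close>

text \<open>Leibniz for \<open>f = f^2\<close> gives \<open>D = 2 f D\<close> with
  \<open>D = B f x\<close>. Multiplying by \<open>f\<close> turns this into
  \<open>f D = 2 f D\<close>, so \<open>f D = 0\<close> and then \<open>D = 0\<close>.\<close>

lemma idempotent_central:
  assumes "M f f = f"
  shows "B f x = 0"
proof -
  let ?D = "B f x"
  have 1: "?D = M f ?D + M f ?D" using B_Leibniz [of f f x] assms M_comm by simp
  have "M f ?D = M f (M f ?D) + M f (M f ?D)" by (subst 1) (rule M_add)
  also have "M f (M f ?D) = M f ?D" by (metis M_assoc assms)
  finally have "M f ?D = 0" by simp
  then show ?thesis using 1 by simp
qed

text \<open>The algebra is the direct sum of a two-dimensional unital algebra, a quotient of C[X] by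
  a quadratic, and the line of \<open>(0,0,1)\<close>. A double root or two simple ones, and a zero
  or nonzero square on the line, give the four cases.\<close>

lemma classified_idempotent_1_0:
  assumes "M11 = (1,0,0)" "M12 = (0,1,0)" "M13 = (0,0,0)"
  shows "classified scale3 M B"
proof -
  obtain a b c where m22: "M22 = (a, b, c)" by (metis prod_cases3)
  obtain a' b' c' where m23: "M23 = (a', b', c')" by (metis prod_cases3)
  obtain p q d where m33: "M33 = (p, q, d)" by (metis prod_cases3)
  obtain p' q' d' where b23: "B23 = (p', q', d')" by (metis prod_cases3)
  note ex = M_expand assms m22 m23 m33
  have c: "c = 0" using M_assoc [of "(1,0,0)" "(0,1,0)" "(0,1,0)"] by (simp add: ex)
  have z23: "a' = 0" "b' = 0" "c' = 0"
    using M_assoc [of "(1,0,0)" "(0,1,0)" "(0,0,1)"] M_assoc [of "(1,0,0)" "(0,0,1)" "(0,1,0)"]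
    by (simp_all add: ex)
  have z33: "p = 0" "q = 0" using M_assoc [of "(1,0,0)" "(0,0,1)" "(0,0,1)"] by (simp_all add: ex)
  have i: "M (1,0,0) (1,0,0) = (1,0,0)" using assms by (simp add: M11_def)
  have B0: "B12 = 0" "B13 = 0" using idempotent_central [OF i] by (simp_all add: B12_def B13_def)
  \<comment> \<open>The bracket of vectors from different eigenspaces of the idempotent lies in both
    eigenspaces.\<close>
  have "p' = 0" "q' = 0" "d' = 0"
    using B_Leibniz [of "(1,0,0)" "(0,1,0)" "(0,0,1)"] B_Leibniz [of "(1,0,0)" "(0,0,1)" "(0,1,0)"]
    by (simp_all add: ex B_expand B0 b23 zero3)
  then have B: "B x y = 0" for x y
    by (cases x; cases y) (simp add: B_expand B0 b23 zero3)
  \<comment> \<open>The second basis vector is a root of \<open>X^2 - b X - a\<close>, which factors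
    as \<open>(X - r) (X - s)\<close>. If \<open>r = s\<close>, subtracting \<open>r\<close> makes
    this vector square to zero.\<close>
  obtain r s where rs: "r + s = b" "r * s = - a" by (rule quadratic_split)
  have a: "a = - (r * s)" and b: "b = r + s" using rs by auto
  note ex = ex c z23 z33 B model_table a b
  show ?thesis
  proof (cases "r = s")
    case True
    show ?thesis
    proof (cases "d = 0")
      case d: True
      show ?thesis
        by (rule classifiedI [of 11 "(1,0,0)" "(-r,1,0)" "(0,0,1)"])
          (simp_all add: ex d True algebra_simps)
    next
      case d: False
      show ?thesis
        by (rule classifiedI [of 8 "(0,0,1/d)" "(1,0,0)" "(-r,1,0)"])
          (use d in \<open>simp_all add: ex True algebra_simps\<close>)
    qed
  next
    case False
    \<comment> \<open>Lagrange interpolation: \<open>(X - s) / (r - s)\<close> and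
      \<open>(X - r) / (s - r)\<close> are orthogonal idempotents with sum 1.\<close>
    then have k: "r - s \<noteq> 0" "s - r \<noteq> 0" by auto
    show ?thesis
    proof (cases "d = 0")
      case d: True
      show ?thesis
        by (rule classifiedI [of 10 "(-s/(r-s),1/(r-s),0)" "(-r/(s-r),1/(s-r),0)" "(0,0,1)"])
          (use k in \<open>simp_all add: ex d divide_simps\<close>, (simp add: algebra_simps)+)
    next
      case d: False
      show ?thesis
        by (rule classifiedI [of 7 "(-s/(r-s),1/(r-s),0)" "(-r/(s-r),1/(s-r),0)" "(0,0,1/d)"])
          (use d k in \<open>simp_all add: ex divide_simps\<close>, (simp add: algebra_simps)+)
    qed
  qed
qed

section \<open>Cayley-Hamilton, idempotents and the Peirce decomposition\<close>

lemma M_minus: "M (- x) y = - M x y" "M x (- y) = - M x y"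
  using M_add(1) [of x "- x" y] M_add(2) [of x y "- y"] by (simp_all add: eq_neg_iff_add_eq_0 add.commute)

lemma M_diff: "M (x - y) z = M x z - M y z" "M x (y - z) = M x y - M x z"
  using M_add(1) [of x "- y" z] M_add(2) [of x y "- z"] by (simp_all add: M_minus)

text \<open>The coefficients are the trace, the sum of the principal minors of size two and the
  determinant of multiplication by \<open>x\<close>. The vector \<open>v\<close> is free because two
  values are needed: \<open>x\<close> in general, and the unit, where the relation becomes
  cubic.\<close>

lemma Cayley_Hamilton:
  obtains t s d where
    "\<And>v. M x (M x (M x v)) = scale3 t (M x (M x v)) - scale3 s (M x v) + scale3 d v"
proof -
  obtain a1 a2 a3 where a: "M x (1,0,0) = (a1,a2,a3)" by (metis prod_cases3)
  obtain b1 b2 b3 where b: "M x (0,1,0) = (b1,b2,b3)" by (metis prod_cases3)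
  obtain c1 c2 c3 where c: "M x (0,0,1) = (c1,c2,c3)" by (metis prod_cases3)
  have L: "M x (p, q, r) =
      (p * a1 + q * b1 + r * c1, p * a2 + q * b2 + r * c2, p * a3 + q * b3 + r * c3)" for p q r
    by (subst triple_expand) (simp only: M_add M_scale a b c, simp)
  show thesis
  proof (rule that)
    fix v :: V3
    obtain p q r where v: "v = (p, q, r)" by (metis prod_cases3)
    show "M x (M x (M x v)) = scale3 (a1 + b2 + c3) (M x (M x v))
        - scale3 (a1*b2 - a2*b1 + a1*c3 - a3*c1 + b2*c3 - b3*c2) (M x v)
        + scale3 (det3 (a1,a2,a3) (b1,b2,b3) (c1,c2,c3)) v"
      by (simp add: v L) (intro conjI; algebra)
  qed
qed

text \<open>The elements fixed by multiplication with \<open>w\<close> form an ideal. It contains \<open>x\<^sup>3\<close>, hence also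
  \<open>w\<^sup>3\<close>, as \<open>w\<close> is a multiple of \<open>x\<close>.\<close>

lemma idempotent_of_stable_cube:
  assumes w: "w = scale3 a x + M x h" and fix3: "M (M x (M x x)) w = M x (M x x)"
    and nz: "M x (M x x) \<noteq> 0"
  obtains f z where "f \<noteq> 0" "M f f = f" "f = M x z"
proof -
  define S where "S = {y. M y w = y}"
  have S_add: "y + z \<in> S" if "y \<in> S" "z \<in> S" for y z using that by (simp add: S_def M_add)
  have S_scale: "scale3 c y \<in> S" if "y \<in> S" for c y using that by (simp add: S_def M_scale)
  have S_mult: "M y z \<in> S" if "y \<in> S" for y z
    using that unfolding S_def mem_Collect_eq by (metis M_assoc M_comm)
  have step: "M k w \<in> S" if "M k x \<in> S" for k
  proof -
    have "M k w = scale3 a (M k x) + M (M k x) h" by (simp add: w M_add M_scale M_assoc)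
    then show ?thesis using that by (simp add: S_add S_scale S_mult)
  qed
  have "M (M x x) x \<in> S" using fix3 by (simp add: S_def M_comm [of "M x x" x])
  then have "M (M x x) w \<in> S" by (rule step)
  then have "M (M x w) x \<in> S" by (metis M_assoc M_comm)
  then have "M (M x w) w \<in> S" by (rule step)
  then have "M (M w w) x \<in> S" by (metis M_assoc M_comm)
  then have f: "M (M w w) w \<in> S" by (rule step)
  let ?f = "M (M w w) w"
  have fw: "M ?f w = ?f" using f by (simp add: S_def)
  then have "M ?f ?f = ?f" by (metis M_assoc)
  \<comment> \<open>Multiplication by \<open>?f\<close> fixes \<open>x^3\<close>, which is
    nonzero.\<close>
  moreover have "M (M x (M x x)) ?f = M x (M x x)" by (metis fix3 M_assoc)
  then have "?f \<noteq> 0" using nz by auto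
  moreover have mult_w: "M w k = M x (scale3 a k + M h k)" for k
    by (simp add: w M_add M_scale M_assoc)
  have "?f = M w (M w w)" by (rule M_comm)
  then have "?f = M x (scale3 a (M w w) + M h (M w w))"
    using mult_w by simp
  ultimately show thesis using that by blast
qed

text \<open>In \<open>x^4 = t x^3 - s x^2 + d x\<close>, the first nonzero one among
  \<open>d\<close>, \<open>s\<close>, \<open>t\<close> can be inverted. This gives \<open>w\<close>
  with \<open>x w = x\<close>, \<open>x^2 w = x^2\<close> or \<open>x^3 w = x^3\<close>
  respectively; if all three vanished, \<open>x^4\<close> would be 0. The conclusion
  \<open>f = M x z\<close> records that \<open>f\<close> lies in every ideal containing
  \<open>x\<close>.\<close>

lemma nilpotent_or_idempotent:
  assumes "M x (M x (M x x)) \<noteq> 0"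
  obtains f z where "f \<noteq> 0" "M f f = f" "f = M x z"
proof -
  interpret V: vector_space scale3 by (rule vector_space_scale3)
  obtain t s d where CH:
    "\<And>v. M x (M x (M x v)) = scale3 t (M x (M x v)) - scale3 s (M x v) + scale3 d v"
    by (rule Cayley_Hamilton) blast
  let ?x2 = "M x x" and ?x3 = "M x (M x x)"
  have nz: "?x3 \<noteq> 0" using assms by auto
  have "\<exists>a h. M ?x3 (scale3 a x + M x h) = ?x3"
  proof (cases "d = 0")
    case d: False
    let ?h = "scale3 (1/d) (?x2 - scale3 t x)"
    have "M x (scale3 (s/d) x + M x ?h) = scale3 (1/d) (scale3 s ?x2 + M x ?x3 - scale3 t ?x3)"
      by (simp only: M_add M_scale M_diff V.scale_right_diff_distrib V.scale_right_distrib V.scale_scale)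
        (simp add: algebra_simps)
    also have "\<dots> = x" using d by (simp add: CH [of x])
    finally have "M x (scale3 (s/d) x + M x ?h) = x" .
    then show ?thesis by (metis M_assoc M_comm)
  next
    case d: True
    show ?thesis
    proof (cases "s = 0")
      case s: False
      let ?w = "scale3 (t/s) x + M x (scale3 (-1/s) x)"
      have "M ?x2 ?w = scale3 (1/s) (scale3 t ?x3 - M x ?x3)"
        by (simp only: M_add M_scale M_assoc V.scale_right_diff_distrib V.scale_scale) simp
      also have "\<dots> = ?x2" using s d by (simp add: CH [of x])
      finally have "M ?x2 ?w = ?x2" .
      then show ?thesis by (metis M_assoc)
    next
      case s: True
      then have "M x ?x3 = scale3 t ?x3" using CH [of x] d by simp
      moreover from this have "t \<noteq> 0" using assms by auto
      ultimately have "M ?x3 (scale3 (1/t) x + M x 0) = ?x3"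
        by (simp add: M_scale M_comm [of ?x3 x])
      then show ?thesis by blast
    qed
  qed
  then obtain a h where "M ?x3 (scale3 a x + M x h) = ?x3" by blast
  then show thesis using idempotent_of_stable_cube [OF refl _ nz] that by metis
qed

text \<open>Each vector \<open>k\<close> is the sum of \<open>M f k\<close> and
  \<open>k - M f k\<close>, with eigenvalues 1 and 0. Expanding the determinant of \<open>f\<close>,
  \<open>y\<close>, \<open>z\<close> accordingly leaves some choice of parts independent.\<close>

lemma Peirce:
  assumes "M f f = f" "det3 f y z \<noteq> 0"
  obtains u v where "det3 f u v \<noteq> 0" "M f u = u \<or> M f u = 0" "M f v = v \<or> M f v = 0"
proof -
  have 1: "M f (M f k) = M f k" for k by (metis M_assoc assms(1))
  then have 0: "M f (k - M f k) = 0" for k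
    by (simp add: M_diff)
  have "det3 f (M f y + (y - M f y)) (M f z + (z - M f z)) \<noteq> 0" using assms(2) by simp
  then have "det3 f (M f y) (M f z) \<noteq> 0 \<or> det3 f (M f y) (z - M f z) \<noteq> 0
    \<or> det3 f (y - M f y) (M f z) \<noteq> 0 \<or> det3 f (y - M f y) (z - M f z) \<noteq> 0"
    unfolding det3_multilinear by auto
  then show thesis using that 0 1 by metis
qed

lemma classified_Peirce_1_0:
  assumes "M f f = f" "det3 f u v \<noteq> 0" "M f u = u" "M f v = 0"
  shows "classified scale3 M B"
  using assms(2)
proof (rule change_basis)
  fix M' B' g
  assume T: "poisson3 M' B'" "poisson_iso scale3 M B scale3 M' B' g" "\<And>x. g x = 0 \<longleftrightarrow> x = 0"
    "g f = (1,0,0)" "g u = (0,1,0)" "poisson3.M11 M' = g (M f f)" "poisson3.M12 M' = g (M f u)"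
    "poisson3.M13 M' = g (M f v)"
  then have "classified scale3 M' B'"
    by (intro poisson3.classified_idempotent_1_0) (simp_all add: assms zero3)
  then show ?thesis by (rule classified_trans [OF T(2)])
qed

lemma pow4: "M x (M x (M x x)) = M (M x x) (M x x)"
  by (metis M_assoc)

text \<open>Multiplying the relation by \<open>x\<close> twice leaves \<open>b x^3 = 0\<close>. A
  nonzero \<open>b\<close> would give \<open>x^3 = 0\<close> and then
  \<open>b x^2 = 0\<close>.\<close>

lemma nilpotent_independent:
  assumes "M x (M x (M x x)) = 0" "M x x \<noteq> 0" "scale3 b x + scale3 c (M x x) = 0"
  shows "b = 0 \<and> c = 0"
proof -
  have 1: "scale3 b (M x x) + scale3 c (M x (M x x)) = 0"
    using arg_cong [OF assms(3), of "M x"] by (simp add: M_add M_scale)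
  have 2: "scale3 b (M x (M x x)) = 0"
    using arg_cong [OF 1, of "M x"] by (simp add: M_add M_scale assms(1))
  have b: "b = 0" using 1 2 assms(2) by (auto simp: scale3_eq_0)
  then show ?thesis using assms(2,3) by (auto simp: scale3_eq_0)
qed

text \<open>The algebra is C[X]/(X^3) with basis \<open>u\<close>, \<open>x\<close>,
  \<open>x^2\<close>. The bracket vanishes: \<open>u\<close> is central, and the derivation
  \<open>{-,x}\<close> kills \<open>x\<close>, hence also \<open>x^2\<close>.\<close>

lemma classified_unit_cubic_nilpotent:
  assumes one: "\<And>y. M u y = y" and nil: "M x (M x (M x x)) = 0" "M x x \<noteq> 0"
  shows "classified scale3 M B"
proof -
  have "det3 u x (M x x) \<noteq> 0"
  proof
    assume "det3 u x (M x x) = 0"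
    then obtain a b c where abc: "(a, b, c) \<noteq> (0, 0, 0)"
      and r: "scale3 a u + scale3 b x + scale3 c (M x x) = 0" by (rule det3_eq_0_dependent)
    have x: "M x u = x" using one M_comm by metis
    have 1: "scale3 a x + scale3 b (M x x) + scale3 c (M x (M x x)) = 0"
      using arg_cong [OF r, of "M x"] by (simp add: M_add M_scale x)
    have 2: "scale3 a (M x x) + scale3 b (M x (M x x)) = 0"
      using arg_cong [OF 1, of "M x"] by (simp add: M_add M_scale nil)
    have 3: "scale3 a (M x (M x x)) = 0"
      using arg_cong [OF 2, of "M x"] by (simp add: M_add M_scale nil)
    have a: "a = 0" using 2 3 nil by (auto simp: scale3_eq_0)
    then show False using r abc nilpotent_independent [OF nil, of b c] by (simp add: scale3_eq_0)
  qed
  then show ?thesis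
  proof (rule change_basis)
    fix M' B' g
    assume T: "poisson3 M' B'" "poisson_iso scale3 M B scale3 M' B' g" "\<And>x. g x = 0 \<longleftrightarrow> x = 0"
      "g u = (1,0,0)" "g x = (0,1,0)" "g (M x x) = (0,0,1)"
      "poisson3.M11 M' = g (M u u)" "poisson3.M12 M' = g (M u x)"
      "poisson3.M13 M' = g (M u (M x x))" "poisson3.M22 M' = g (M x x)"
      "poisson3.M33 M' = g (M (M x x) (M x x))"
    interpret T: poisson3 M' B' by (rule T(1))
    have M: "T.M11 = (1,0,0)" "T.M12 = (0,1,0)" "T.M13 = (0,0,1)" "T.M22 = (0,0,1)" "T.M33 = 0"
      using T nil by (simp_all add: one pow4)
    \<comment> \<open>The coordinates of \<open>x^3\<close>. Multiplying by \<open>x\<close> gives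
      \<open>x^4 = 0\<close>, hence \<open>b = -c^2\<close>, \<open>a = c^3\<close> and
      \<open>c^4 = 0\<close>, so \<open>x^3\<close> vanishes as well.\<close>
    obtain a b c where m23: "T.M23 = (a, b, c)" by (metis prod_cases3)
    have "c * a = 0" "a + c * b = 0" "b + c * c = 0"
      using T.M_assoc [of "(0,1,0)" "(0,1,0)" "(0,0,1)"]
      by (simp_all add: T.M_expand M m23 zero3)
    then have "c ^ 4 = 0" by algebra
    then have "c = 0" by simp
    then have m23: "T.M23 = 0" using m23 \<open>b + c * c = 0\<close> \<open>a + c * b = 0\<close> by (simp add: zero3)
    have "T.B12 = 0" "T.B13 = 0"
      using T.idempotent_central [of "(1,0,0)"] M(1) by (simp_all add: T.M11_def T.B12_def T.B13_def)
    moreover have "T.B23 = 0"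
      using T.B_Leibniz [of "(0,1,0)" "(0,1,0)" "(0,1,0)"]
      by (cases T.B23) (simp add: T.M_expand T.B_expand M zero3)
    ultimately have "classified scale3 M' B'"
      by (intro T.classifiedI [of 9 "(1,0,0)" "(0,1,0)" "(0,0,1)"])
        (simp_all add: T.M_expand T.B_expand M m23 model_table)
    then show ?thesis by (rule classified_trans [OF T(2)])
  qed
qed

lemma classified_unit_square_zero:
  assumes "M11 = (1,0,0)" "M12 = (0,1,0)" "M13 = (0,0,1)" "M22 = 0" "M33 = 0"
  shows "classified scale3 M B"
proof -
  \<comment> \<open>Multiplying this product by either of its factors gives 0, which forces it to
    vanish.\<close>
  obtain a b c where m23: "M23 = (a, b, c)" by (metis prod_cases3)
  note ex = M_expand B_expand assms m23 zero3
  have "c * a = 0" "a + c * b = 0" "c * c = 0" "a + b * c = 0" "b * b = 0"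
    using M_assoc [of "(0,1,0)" "(0,1,0)" "(0,0,1)"] M_assoc [of "(0,0,1)" "(0,0,1)" "(0,1,0)"]
    by (simp_all add: ex)
  then have m23: "M23 = 0" using m23 by (simp add: zero3)
  obtain p q r where b23: "B23 = (p, q, r)" by (metis prod_cases3)
  have B1: "B12 = 0" "B13 = 0"
    using idempotent_central [of "(1,0,0)"] assms(1) by (simp_all add: M11_def B12_def B13_def)
  note ex = M_expand B_expand assms m23 b23 B1 zero3
  have p: "p = 0"
    using B_Leibniz [of "(0,1,0)" "(0,1,0)" "(0,0,1)"] by (simp add: ex)
  \<comment> \<open>What remains is a Lie bracket on the plane of the last two coordinates. If it is
    nonzero, \<open>B23\<close> becomes the second basis vector, and the third is chosen so that the
    bracket of the two is again \<open>B23\<close>.\<close>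
  consider "q = 0" "r = 0" | "q \<noteq> 0" | "q = 0" "r \<noteq> 0" by blast
  then show ?thesis
  proof cases
    case 1
    then show ?thesis
      by (intro classifiedI [of 17 "(1,0,0)" "(0,1,0)" "(0,0,1)"])
        (simp_all add: ex p model_table)
  next
    case 2
    then show ?thesis
      by (intro classifiedI [of 18 "(1,0,0)" "(0,q,r)" "(0,0,1/q)"])
        (simp_all add: ex p model_table)
  next
    case 3
    then show ?thesis
      by (intro classifiedI [of 18 "(1,0,0)" "(0,0,r)" "(0,-1/r,0)"])
        (simp_all add: ex p model_table)
  qed
qed

text \<open>A nontrivial idempotent, or its complement in the unit, has both eigenvalues 1 and 0 on
  the rest of an adapted basis. Without one the algebra is local: every element is a scalar plus a
  nilpotent, and the squares of the nilpotents decide.\<close>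

lemma classified_unital:
  assumes one: "\<And>y. M o1 y = y" and "o1 \<noteq> 0"
  shows "classified scale3 M B"
proof (cases "\<exists>f. M f f = f \<and> f \<noteq> 0 \<and> f \<noteq> o1")
  case True
  then obtain f where f: "M f f = f" "f \<noteq> 0" "f \<noteq> o1" by blast
  obtain y z where "det3 f y z \<noteq> 0" using det3_extend1 [OF f(2)] .
  then obtain u v where uv: "det3 f u v \<noteq> 0" "M f u = u \<or> M f u = 0" "M f v = v \<or> M f v = 0"
    using Peirce [OF f(1)] by metis
  consider "M f u = u" "M f v = 0" | "M f u = 0" "M f v = v" | "M f u = u" "M f v = v"
    | "M f u = 0" "M f v = 0" using uv by blast
  then show ?thesis
  proof cases
    case 1 then show ?thesis using classified_Peirce_1_0 f uv by blast
  next
    case 2 then show ?thesis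
      using classified_Peirce_1_0 [of f v u] f uv det3_swap [of f u v] by simp
  next
    case 3
    obtain a b c where "o1 = scale3 a f + scale3 b u + scale3 c v"
      using det3_span [OF uv(1)] .
    then have "M f o1 = o1" by (simp add: M_add M_scale f 3)
    then show ?thesis using f one M_comm by metis
  next
    case 4
    obtain a b c where o: "o1 = scale3 a f + scale3 b u + scale3 c v"
      using det3_span [OF uv(1)] .
    then have "M f o1 = scale3 a f" by (simp add: M_add M_scale f 4)
    then have "scale3 a f = f" using one M_comm by metis
    \<comment> \<open>\<open>h\<close> is the complementary idempotent \<open>o1 - f\<close>. It
      lies in the span of \<open>u\<close> and \<open>v\<close>, fixes both and annihilates
      \<open>f\<close>, so it forms an adapted basis with \<open>f\<close> and one of
      \<open>u\<close>, \<open>v\<close>.\<close>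
    define h where "h = scale3 b u + scale3 c v"
    have o': "o1 = f + h" using o \<open>scale3 a f = f\<close> by (simp add: h_def add.assoc)
    have hf: "M h f = 0" unfolding M_comm [of h f] by (simp add: h_def M_add M_scale 4)
    have hy: "M h y + M f y = y" for y using one [of y] unfolding o' by (simp add: M_add add.commute)
    have hu: "M h u = u" "M h v = v" using hy [of u] hy [of v] 4 by simp_all
    have hh: "M h h = h" using hy [of h] hf M_comm [of h f] by simp
    have "det3 h v f = b * det3 f u v" "det3 h u f = - c * det3 f u v"
      unfolding h_def by (cases f; cases u; cases v; simp add: algebra_simps)+
    moreover have "b \<noteq> 0 \<or> c \<noteq> 0"
      using o' f(3) by (auto simp: h_def scale3_eq_0)
    ultimately show ?thesis
      using classified_Peirce_1_0 [OF hh _ _ hf] hu uv(1) by (metis mult_eq_0_iff neg_equal_0_iff_equal)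
  qed
next
  case False
  then have triv: "f = 0 \<or> f = o1" if "M f f = f" for f using that by blast
  have dich: "M x (M x (M x x)) = 0 \<or> (\<exists>z. M x z = o1)" for x
    using nilpotent_or_idempotent triv by metis
  \<comment> \<open>Otherwise every shift of \<open>u\<close> by a scalar would be invertible by
    \<open>dich\<close>, while Cayley-Hamilton applied to the unit writes 0 as a product of three
    such shifts.\<close>
  have nil: "\<exists>l. let x = u - scale3 l o1 in M x (M x (M x x)) = 0" for u
  proof (rule ccontr)
    assume "\<not> ?thesis"
    then have inv: "\<exists>z. M (u - scale3 l o1) z = o1" for l using dich by (metis (full_types))
    have u: "M u o1 = u" using one M_comm by metis
    obtain t s d where "M u (M u (M u o1)) = scale3 t (M u (M u o1)) - scale3 s (M u o1) + scale3 d o1"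
      using Cayley_Hamilton by metis
    then have CH: "M u (M u u) = scale3 t (M u u) - scale3 s u + scale3 d o1" by (simp add: u)
    obtain l m n where lmn: "l + m + n = t" "l * m + l * n + m * n = s" "l * m * n = d"
      by (rule cubic_split)
    have "M (u - scale3 l o1) (M (u - scale3 m o1) (u - scale3 n o1)) =
        M u (M u u) - (scale3 t (M u u) - scale3 s u + scale3 d o1)"
      unfolding M_diff M_scale one u lmn [symmetric]
      by (cases u; cases o1; cases "M u u"; cases "M u (M u u)") (simp add: algebra_simps)
    then have 0: "M (u - scale3 l o1) (M (u - scale3 m o1) (u - scale3 n o1)) = 0" using CH by simp
    obtain z1 z2 z3 where z: "M (u - scale3 l o1) z1 = o1" "M (u - scale3 m o1) z2 = o1"
      "M (u - scale3 n o1) z3 = o1" using inv by metis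
    have cancel: "y = 0" if "M x y = 0" "M x z = o1" for x y z
    proof -
      have "y = M (M x z) y" using one that by simp
      also have "\<dots> = M z (M x y)" using M_assoc M_comm by metis
      finally show ?thesis using that by simp
    qed
    have "u - scale3 n o1 = 0" using cancel [OF cancel [OF 0 z(1)] z(2)] .
    then show False using z(3) assms(2) by simp
  qed
  obtain v w where "det3 o1 v w \<noteq> 0" using det3_extend1 [OF assms(2)] .
  obtain l m where l: "let x = v - scale3 l o1 in M x (M x (M x x)) = 0"
    and m: "let x = w - scale3 m o1 in M x (M x (M x x)) = 0" using nil by metis
  let ?v = "v - scale3 l o1" and ?w = "w - scale3 m o1"
  have d: "det3 o1 ?v ?w \<noteq> 0"
    using \<open>det3 o1 v w \<noteq> 0\<close> by (cases o1; cases v; cases w) (simp add: algebra_simps)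
  show ?thesis
  proof (cases "M ?v ?v = 0 \<and> M ?w ?w = 0")
    case False
    then show ?thesis using classified_unit_cubic_nilpotent one l m unfolding Let_def by metis
  next
    case True
    show ?thesis using d
    proof (rule change_basis)
      fix M' B' g
      assume T: "poisson3 M' B'" "poisson_iso scale3 M B scale3 M' B' g" "\<And>x. g x = 0 \<longleftrightarrow> x = 0"
        "g o1 = (1,0,0)" "g ?v = (0,1,0)" "g ?w = (0,0,1)"
        "poisson3.M11 M' = g (M o1 o1)" "poisson3.M12 M' = g (M o1 ?v)"
        "poisson3.M13 M' = g (M o1 ?w)" "poisson3.M22 M' = g (M ?v ?v)"
        "poisson3.M33 M' = g (M ?w ?w)"
      then have "classified scale3 M' B'" using True
        by (intro poisson3.classified_unit_square_zero) (simp_all add: one)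
      then show ?thesis by (rule classified_trans [OF T(2)])
    qed
  qed
qed

text \<open>Stated relative to a set because it is applied both to the whole space and to the plane
  with vanishing first coordinate.\<close>

lemma polarize_square:
  assumes "\<And>x. x \<in> S \<Longrightarrow> M x x = 0" "x \<in> S" "y \<in> S" "x + y \<in> S"
  shows "M x y = 0"
proof -
  have "M x x + M y x + (M x y + M y y) = 0"
    using assms(1) [OF assms(4)] by (simp only: M_add)
  then have "M x y + M x y = 0" using assms M_comm [of y x] by simp
  then show ?thesis by (simp add: double_eq_0)
qed

text \<open>The algebra is the direct sum of the line of \<open>f\<close> and the span of
  \<open>x\<close> and \<open>x^2\<close>, where \<open>x^3 = 0\<close>. The coordinate of
  \<open>x^3\<close> along \<open>f\<close> vanishes because \<open>f\<close> annihilates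
  \<open>x\<close>.\<close>

lemma classified_idempotent_cubic_nilpotent:
  assumes f: "M f f = f" "f \<noteq> 0" and fx: "M f x = 0"
    and nil: "M x (M x (M x x)) = 0" "M x x \<noteq> 0"
  shows "classified scale3 M B"
proof -
  have fxx: "M f (M x x) = 0" using fx M_assoc [of f x x] by simp
  have "det3 f x (M x x) \<noteq> 0"
  proof
    assume "det3 f x (M x x) = 0"
    then obtain a b c where abc: "(a, b, c) \<noteq> (0, 0, 0)"
      and r: "scale3 a f + scale3 b x + scale3 c (M x x) = 0" by (rule det3_eq_0_dependent)
    have "scale3 a f = 0"
      using arg_cong [OF r, of "M f"] by (simp add: M_add M_scale f fx fxx)
    then have "a = 0" using f by (simp add: scale3_eq_0)
    then show False using r abc nilpotent_independent [OF nil, of b c] by simp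
  qed
  then show ?thesis
  proof (rule change_basis)
    fix M' B' g
    assume T: "poisson3 M' B'" "poisson_iso scale3 M B scale3 M' B' g" "\<And>x. g x = 0 \<longleftrightarrow> x = 0"
      "g f = (1,0,0)" "g x = (0,1,0)" "g (M x x) = (0,0,1)"
      "poisson3.M11 M' = g (M f f)" "poisson3.M12 M' = g (M f x)"
      "poisson3.M13 M' = g (M f (M x x))" "poisson3.M22 M' = g (M x x)"
      "poisson3.M33 M' = g (M (M x x) (M x x))"
    interpret T: poisson3 M' B' by (rule T(1))
    have M: "T.M11 = (1,0,0)" "T.M12 = 0" "T.M13 = 0" "T.M22 = (0,0,1)" "T.M33 = 0"
      using T nil by (simp_all add: f fx fxx pow4)
    obtain a b c where m23: "T.M23 = (a, b, c)" by (metis prod_cases3)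
    have "a = 0"
      using T.M_assoc [of "(1,0,0)" "(0,1,0)" "(0,0,1)"]
      by (simp_all add: T.M_expand M m23 zero3)
    moreover have "c * b = 0" "b + c * c = 0"
      using T.M_assoc [of "(0,1,0)" "(0,1,0)" "(0,0,1)"]
      by (simp_all add: T.M_expand M m23 zero3)
    moreover from this have "c = 0" by auto
    ultimately have m23: "T.M23 = 0" using m23 by (simp add: zero3)
    have B1: "T.B12 = 0" "T.B13 = 0"
      using T.idempotent_central [of "(1,0,0)"] M(1) by (simp_all add: T.M11_def T.B12_def T.B13_def)
    moreover have "T.B23 = 0"
      using T.B_Leibniz [of "(0,1,0)" "(0,1,0)" "(0,1,0)"]
      by (cases T.B23) (simp add: T.M_expand T.B_expand M zero3)
    ultimately have "classified scale3 M' B'"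
      by (intro T.classifiedI [of 12 "(1,0,0)" "(0,1,0)" "(0,0,1)"])
        (simp_all add: T.M_expand T.B_expand M m23 model_table)
    then show ?thesis by (rule classified_trans [OF T(2)])
  qed
qed

text \<open>This reduces to eigenvalues 1 and 0 on an adapted basis: for \<open>f\<close>, with
  \<open>M f w\<close> and \<open>k\<close>, if these three are independent; otherwise for
  \<open>k + f\<close>, with \<open>f\<close> and the part of \<open>w\<close> that \<open>f\<close>
  annihilates.\<close>

lemma classified_orthogonal_idempotents:
  assumes k: "M k k = k" and f: "M f f = f" and kf: "M k f = 0"
    and w: "M k w = 0" and d: "det3 f k w \<noteq> 0"
  shows "classified scale3 M B"
proof -
  have fk: "M f k = 0" using kf M_comm by metis
  let ?w = "w - M f w"
  have "det3 f k (M f w + ?w) \<noteq> 0" using d by simp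
  then consider "det3 f k (M f w) \<noteq> 0" | "det3 f k ?w \<noteq> 0"
    unfolding det3_multilinear by (metis add.right_neutral)
  then show ?thesis
  proof cases
    case 1
    moreover have "M f (M f w) = M f w" using f M_assoc by metis
    ultimately show ?thesis
      using classified_Peirce_1_0 [OF f, of "M f w" k] fk det3_swap [of f k "M f w"] by simp
  next
    case 2
    have fw: "M f ?w = 0" using f M_assoc [of f f w] by (simp add: M_diff)
    have "M k (M f w) = 0" using M_assoc [of k f w] kf by simp
    then have kw: "M k ?w = 0" using w by (simp add: M_diff)
    have "det3 (k + f) f ?w \<noteq> 0" using 2 by (simp add: det3_shear)
    then show ?thesis
      by (intro classified_Peirce_1_0 [of "k + f" f ?w]) (simp_all add: M_add k f kf fk fw kw)
  qed
qed

text \<open>The eigenspace 0 is an ideal, so idempotents built from its elements stay in it. It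
  contains a second idempotent, or an element with nonzero square and vanishing fourth power, or its
  product is zero and only a Lie bracket is left.\<close>

lemma classified_idempotent_0_0:
  assumes "M11 = (1,0,0)" "M12 = 0" "M13 = 0"
  shows "classified scale3 M B"
proof -
  let ?k = "(1,0,0) :: V3"
  have k: "M ?k ?k = ?k" using assms by (simp add: M11_def)
  have k0: "M ?k (0,p,q) = 0" for p q using assms by (simp add: M_expand zero3)
  have kM: "\<exists>p q. M x y = (0,p,q)" if "M ?k x = 0" for x y
  proof -
    obtain r p q where "M x y = (r, p, q)" by (metis prod_cases3)
    moreover have "M ?k (M x y) = 0" using that M_assoc [of ?k x y] by simp
    ultimately show ?thesis by (simp add: M_expand assms zero3)
  qed
  show ?thesis
  proof (cases "\<exists>p q. (p, q) \<noteq> (0, 0) \<and> M (0,p,q) (0,p,q) = (0,p,q)")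
    case True
    then obtain p q where pq: "(p, q) \<noteq> (0, 0)" and f: "M (0,p,q) (0,p,q) = (0,p,q)" by blast
    have "det3 (0,p,q) ?k (0,0,1) \<noteq> 0 \<or> det3 (0,p,q) ?k (0,1,0) \<noteq> 0" using pq by auto
    then show ?thesis using classified_orthogonal_idempotents [OF k f k0 k0] by blast
  next
    case False
    have nil: "M x (M x (M x x)) = 0" if x: "x = (0,p,q)" for x p q
    proof (rule ccontr)
      assume "M x (M x (M x x)) \<noteq> 0"
      then obtain f z where f: "f \<noteq> 0" "M f f = f" "f = M x z" by (rule nilpotent_or_idempotent)
      then obtain r s where "f = (0,r,s)" using kM [of x z] k0 x by metis
      then show False using f False by (auto simp: zero3)
    qed
    show ?thesis
    proof (cases "\<exists>p q. M (0,p,q) (0,p,q) \<noteq> 0")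
      case True
      then show ?thesis
        using classified_idempotent_cubic_nilpotent [OF k _ k0 nil] by (auto simp: zero3)
    next
      case False
      then have sq: "M x x = 0" if "fst x = 0" for x
        using that by (cases x) auto
      have "M (0,1,0) (0,1,0) = 0" "M (0,1,0) (0,0,1) = 0" "M (0,0,1) (0,0,1) = 0"
        by (rule polarize_square [of "{x. fst x = 0}"]; simp add: sq)+
      then have M: "M22 = 0" "M23 = 0" "M33 = 0" by (simp_all add: M22_def M23_def M33_def)
      have B1: "B12 = 0" "B13 = 0"
        using idempotent_central [OF k] by (simp_all add: B12_def B13_def)
      obtain r p q where b23: "B23 = (r, p, q)" by (metis prod_cases3)
      note ex = M_expand B_expand assms M B1 b23 zero3
      have r: "r = 0" using B_Leibniz [of ?k "(0,1,0)" "(0,0,1)"] by (simp add: ex)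
      \<comment> \<open>A nonzero bracket on the plane is normalised by taking \<open>B23\<close> as
        second basis vector.\<close>
      consider "p = 0" "q = 0" | "p \<noteq> 0" | "p = 0" "q \<noteq> 0" by blast
      then show ?thesis
      proof cases
        case 1
        then show ?thesis
          by (intro classifiedI [of 19 "(1,0,0)" "(0,1,0)" "(0,0,1)"])
            (simp_all add: ex r model_table)
      next
        case 2
        then show ?thesis
          by (intro classifiedI [of 20 "(1,0,0)" "(0,p,q)" "(0,0,1/p)"])
            (simp_all add: ex r model_table)
      next
        case 3
        then show ?thesis
          by (intro classifiedI [of 20 "(1,0,0)" "(0,0,q)" "(0,-1/q,0)"])
            (simp_all add: ex r model_table)
      qed
    qed
  qed
qed

lemma classified_idempotent:
  assumes f: "M f f = f" "f \<noteq> 0"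
  shows "classified scale3 M B"
proof -
  obtain y z where "det3 f y z \<noteq> 0" using det3_extend1 [OF f(2)] .
  then obtain u v where uv: "det3 f u v \<noteq> 0" "M f u = u \<or> M f u = 0" "M f v = v \<or> M f v = 0"
    using Peirce [OF f(1)] by metis
  consider "M f u = u" "M f v = 0" | "M f u = 0" "M f v = v" | "M f u = u" "M f v = v"
    | "M f u = 0" "M f v = 0" using uv by blast
  then show ?thesis
  proof cases
    case 1 then show ?thesis using classified_Peirce_1_0 f uv by blast
  next
    case 2 then show ?thesis
      using classified_Peirce_1_0 [of f v u] f uv det3_swap [of f u v] by simp
  next
    case 3
    have "M f y = y" for y
    proof -
      obtain a b c where "y = scale3 a f + scale3 b u + scale3 c v"
        using det3_span [OF uv(1)] .
      then show ?thesis by (simp add: M_add M_scale f 3)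
    qed
    then show ?thesis using classified_unital f by blast
  next
    case 4
    from uv(1) show ?thesis
    proof (rule change_basis)
      fix M' B' g
      assume T: "poisson3 M' B'" "poisson_iso scale3 M B scale3 M' B' g" "\<And>x. g x = 0 \<longleftrightarrow> x = 0"
        "g f = (1,0,0)" "poisson3.M11 M' = g (M f f)" "poisson3.M12 M' = g (M f u)"
        "poisson3.M13 M' = g (M f v)"
      then have "classified scale3 M' B'"
        by (intro poisson3.classified_idempotent_0_0) (simp_all add: f 4)
      then show ?thesis by (rule classified_trans [OF T(2)])
    qed
  qed
qed

subsection \<open>Nilpotent products\<close>

text \<open>The product is that of the ideal generated by X in C[X]/(X^4). All basis vectors are
  powers of \<open>x\<close>, so Leibniz makes the bracket vanish.\<close>

lemma classified_nilpotent_quartic: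
  assumes nil: "M x (M x (M x x)) = 0" and nz: "M x (M x x) \<noteq> 0"
  shows "classified scale3 M B"
proof -
  have nz2: "M x x \<noteq> 0" using nz by auto
  have "det3 x (M x x) (M x (M x x)) \<noteq> 0"
  proof
    assume "det3 x (M x x) (M x (M x x)) = 0"
    then obtain a b c where abc: "(a, b, c) \<noteq> (0, 0, 0)"
      and r: "scale3 a x + scale3 b (M x x) + scale3 c (M x (M x x)) = 0"
      by (rule det3_eq_0_dependent)
    have 1: "scale3 a (M x x) + scale3 b (M x (M x x)) = 0"
      using arg_cong [OF r, of "M x"] by (simp add: M_add M_scale nil)
    have "scale3 a (M x (M x x)) = 0"
      using arg_cong [OF 1, of "M x"] by (simp add: M_add M_scale nil)
    then have "a = 0" using nz by (simp add: scale3_eq_0)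
    moreover from this have "b = 0" using 1 nz by (simp add: scale3_eq_0)
    ultimately show False using r abc nz by (simp add: scale3_eq_0)
  qed
  then show ?thesis
  proof (rule change_basis)
    fix M' B' g
    assume T: "poisson3 M' B'" "poisson_iso scale3 M B scale3 M' B' g" "\<And>x. g x = 0 \<longleftrightarrow> x = 0"
      "g x = (1,0,0)" "g (M x x) = (0,1,0)" "g (M x (M x x)) = (0,0,1)"
      "poisson3.M11 M' = g (M x x)" "poisson3.M12 M' = g (M x (M x x))"
      "poisson3.M13 M' = g (M x (M x (M x x)))" "poisson3.M22 M' = g (M (M x x) (M x x))"
      "poisson3.M23 M' = g (M (M x x) (M x (M x x)))"
      "poisson3.M33 M' = g (M (M x (M x x)) (M x (M x x)))"
    interpret T: poisson3 M' B' by (rule T(1))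
    have "M (M x x) (M x (M x x)) = 0" "M (M x (M x x)) (M x (M x x)) = 0" "M (M x x) (M x x) = 0"
      using nil by (simp_all add: M_assoc)
    then have M: "T.M11 = (0,1,0)" "T.M12 = (0,0,1)" "T.M13 = 0" "T.M22 = 0" "T.M23 = 0" "T.M33 = 0"
      using T nil by simp_all
    have b12: "T.B12 = 0"
      using T.B_Leibniz [of "(1,0,0)" "(1,0,0)" "(1,0,0)"]
      by (cases T.B12) (simp add: T.M_expand T.B_expand M zero3)
    have b13: "T.B13 = 0"
      using T.B_Leibniz [of "(1,0,0)" "(0,1,0)" "(1,0,0)"]
      by (cases T.B13) (simp add: T.M_expand T.B_expand M b12 zero3)
    have "T.B23 = 0"
      using T.B_Leibniz [of "(1,0,0)" "(1,0,0)" "(0,0,1)"]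
      by (cases T.B23) (simp add: T.M_expand T.B_expand M b12 b13 zero3)
    then have "classified scale3 M' B'"
      by (intro T.classifiedI [of 6 "(1,0,0)" "(0,1,0)" "(0,0,1)"])
        (simp_all add: T.M_expand T.B_expand M b12 b13 model_table)
    then show ?thesis by (rule classified_trans [OF T(2)])
  qed
qed

lemma classified_square_e2:
  assumes "M11 = (0,1,0)" "M12 = 0" "M13 = 0" "M22 = 0" "M23 = 0" "M33 = 0"
  shows "classified scale3 M B"
proof -
  obtain a b c where b13: "B13 = (a, b, c)" by (metis prod_cases3)
  note ex = M_expand B_expand assms zero3
  have b12: "B12 = 0"
    using B_Leibniz [of "(1,0,0)" "(1,0,0)" "(1,0,0)"] by (cases B12) (simp add: ex)
  have a: "a = 0"
    using B_Leibniz [of "(1,0,0)" "(0,0,1)" "(1,0,0)"] by (simp add: ex b12 b13)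
  have b23: "B23 = 0"
    using B_Leibniz [of "(1,0,0)" "(1,0,0)" "(0,0,1)"] by (cases B23) (simp add: ex b12 b13 a)
  note ex = ex b12 b13 b23 a model_table
  \<comment> \<open>\<open>{e1,e3}\<close> is an eigenvector of \<open>{e1,-}\<close> for
    \<open>c\<close> when \<open>c\<close> is nonzero. It then becomes the third vector,
    \<open>e1\<close> is divided by \<open>c\<close>, and the second vector has to be the square of
    the first.\<close>
  consider "c \<noteq> 0" | "c = 0" "b \<noteq> 0" | "c = 0" "b = 0" by blast
  then show ?thesis
  proof cases
    case 1
    then show ?thesis
      by (intro classifiedI [of 14 "(1/c,0,0)" "(0,1/c^2,0)" "(0,b,c)"])
        (simp_all add: ex power2_eq_square)
  next
    case 2
    then show ?thesis
      by (intro classifiedI [of 15 "(1,0,0)" "(0,1,0)" "(0,0,1/b)"])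
        (simp_all add: ex)
  next
    case 3
    then show ?thesis
      by (intro classifiedI [of 13 "(1,0,0)" "(0,1,0)" "(0,0,1)"])
        (simp_all add: ex)
  qed
qed

text \<open>Leibniz leaves a single coefficient of the bracket, which is the parameter of the
  family.\<close>

lemma classified_product_e3:
  assumes "M11 = 0" "M12 = (0,0,1)" "M13 = 0" "M22 = 0" "M23 = 0" "M33 = 0"
  shows "classified scale3 M B"
proof -
  obtain a b c where b12: "B12 = (a, b, c)" by (metis prod_cases3)
  note ex = M_expand B_expand assms zero3
  have ab: "b = 0" "a = 0"
    using B_Leibniz [of "(1,0,0)" "(1,0,0)" "(0,1,0)"] B_Leibniz [of "(0,1,0)" "(0,1,0)" "(1,0,0)"]
    by (simp_all add: ex b12)
  have b13: "B13 = 0"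
    using B_Leibniz [of "(1,0,0)" "(0,1,0)" "(1,0,0)"] by (cases B13) (simp add: ex b12 ab)
  have b23: "B23 = 0"
    using B_Leibniz [of "(1,0,0)" "(0,1,0)" "(0,1,0)"] by (cases B23) (simp add: ex b12 ab)
  show ?thesis
    by (intro classifiedI [of 16 "(1,0,0)" "(0,1,0)" "(0,0,1)" c])
      (simp_all add: ex b12 b13 b23 ab model_table)
qed

text \<open>Polarising the cubic identity gives \<open>x y z = 0\<close> for all triples. With
  \<open>x^2\<close> nonzero and \<open>y\<close> completing \<open>x\<close>, \<open>x^2\<close> to
  a basis, all products are multiples of \<open>x^2\<close>, and the rank of the resulting form on
  the span of \<open>x\<close> and \<open>y\<close> decides between the two tables.\<close>

lemma classified_cubes_zero:
  assumes cube: "\<And>x. M x (M x x) = 0" and nz: "M x y \<noteq> 0"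
  shows "classified scale3 M B"
proof -
  have xyy: "M x (M y y) = 0" for x y
  proof -
    have p: "M (x + y) (M (x + y) (x + y)) = 0" and m: "M (x - y) (M (x - y) (x - y)) = 0"
      by (rule cube)+
    have yx: "M y x = M x y" "M y (M x y) = M x (M y y)" "M y (M x x) = M x (M x y)"
      using M_assoc M_comm by metis+
    have "scale3 3 (M x (M x y)) + scale3 3 (M x (M y y)) = 0"
      using p cube [of x] cube [of y]
      by (simp only: M_add yx) (cases "M x (M x y)"; cases "M x (M y y)"; simp add: zero3 algebra_simps)
    moreover have "scale3 (-3) (M x (M x y)) + scale3 3 (M x (M y y)) = 0"
      using m cube [of x] cube [of y]
      by (simp only: M_diff yx) (cases "M x (M x y)"; cases "M x (M y y)"; simp add: zero3 algebra_simps)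
    ultimately show ?thesis
      by (cases "M x (M x y)"; cases "M x (M y y)") (auto simp: zero3)
  qed
  have xyz: "M x (M y z) = 0" for x y z
  proof -
    have "M x (M (y + z) (y + z)) = 0" by (rule xyy)
    then have "M x (M y z) + M x (M y z) = 0"
      by (simp add: M_add xyy M_comm [of z y])
    then show ?thesis by (simp add: double_eq_0)
  qed
  obtain x where x: "M x x \<noteq> 0" using polarize_square [of UNIV x y] nz by auto
  have "a = 0 \<and> b = 0" if "scale3 a x + scale3 b (M x x) = 0" for a b
    using nilpotent_independent [OF _ x that] xyz by simp
  then obtain y where d: "det3 x (M x x) y \<noteq> 0" using det3_extend2 by metis
  then show ?thesis
  proof (rule change_basis)
    fix M' B' g
    assume T: "poisson3 M' B'" "poisson_iso scale3 M B scale3 M' B' g" "surj g"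
      "\<And>x. g x = 0 \<longleftrightarrow> x = 0" "\<And>x y. M' (g x) (g y) = g (M x y)"
      "g x = (1,0,0)" "g (M x x) = (0,1,0)"
      "poisson3.M11 M' = g (M x x)" "poisson3.M12 M' = g (M x (M x x))"
      "poisson3.M22 M' = g (M (M x x) (M x x))" "poisson3.M23 M' = g (M (M x x) y)"
    interpret T: poisson3 M' B' by (rule T(1))
    have xyz': "M' p (M' q r) = 0" for p q r
    proof -
      obtain p' q' r' where "p = g p'" "q = g q'" "r = g r'" using T(3) by (metis surj_def)
      then show ?thesis by (simp add: T(4,5) xyz)
    qed
    have M: "T.M11 = (0,1,0)" "T.M12 = 0" "T.M22 = 0" "T.M23 = 0"
      using T xyz M_comm [of "M x x" y] by simp_all
    obtain a b c where m13: "T.M13 = (a, b, c)" by (metis prod_cases3)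
    obtain p q r where m33: "T.M33 = (p, q, r)" by (metis prod_cases3)
    note ex = T.M_expand M m13 m33 zero3
    \<comment> \<open>Since triple products vanish, \<open>x y\<close> and \<open>y^2\<close> are
      forced into the line of \<open>x^2\<close>.\<close>
    have "c * a = 0" "a + c * b = 0" "c * c = 0"
      using xyz' [of "(1,0,0)" "(1,0,0)" "(0,0,1)"] by (auto simp: ex)
    then have ac: "a = 0" "c = 0" by auto
    have "r = 0" using xyz' [of "(0,0,1)" "(0,0,1)" "(0,0,1)"] by (simp add: ex ac)
    moreover have "p + r * b = 0" using xyz' [of "(1,0,0)" "(0,0,1)" "(0,0,1)"] by (simp add: ex ac)
    ultimately have pr: "r = 0" "p = 0" by auto
    note ex = T.M_expand M m13 m33 ac pr
    have "classified scale3 M' B'"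
    \<comment> \<open>\<open>q - b^2\<close> is the determinant of the form. When it is 0,
      \<open>y - b x\<close> is orthogonal to \<open>x\<close> and to itself.\<close>
    proof (cases "q = b * b")
      case True
      have "det3 (1,0,0) (0,1,0) (-b,0,1) \<noteq> 0" by simp
      then show ?thesis
      proof (rule T.change_basis)
        fix N C h
        assume H: "poisson3 N C" "poisson_iso scale3 M' B' scale3 N C h" "\<And>x. h x = 0 \<longleftrightarrow> x = 0"
          "h (1,0,0) = (1,0,0)" "h (0,1,0) = (0,1,0)"
          "poisson3.M11 N = h (M' (1,0,0) (1,0,0))" "poisson3.M12 N = h (M' (1,0,0) (0,1,0))"
          "poisson3.M13 N = h (M' (1,0,0) (-b,0,1))" "poisson3.M22 N = h (M' (0,1,0) (0,1,0))"
          "poisson3.M23 N = h (M' (0,1,0) (-b,0,1))" "poisson3.M33 N = h (M' (-b,0,1) (-b,0,1))"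
        have "h (0,0,0) = (0,0,0)" using H(3) by (simp add: zero3)
        then have "classified scale3 N C" using H
          by (intro poisson3.classified_square_e2) (simp_all add: ex True zero3 algebra_simps)
        then show ?thesis by (rule classified_trans [OF H(2)])
      qed
    next
      case False
      define k where "k = q - b * b"
      have k: "k \<noteq> 0" "q = k + b * b" using False by (simp_all add: k_def)
      \<comment> \<open>Chosen so that \<open>x + t (y - b x)\<close> and
        \<open>x - t (y - b x)\<close> have square zero. Their product is then \<open>2 x^2\<close>,
        whence the third basis vector \<open>(0,2,0)\<close>.\<close>
      define t where "t = csqrt (- 1 / k)"
      have "t\<^sup>2 = - 1 / k" by (simp add: t_def)
      then have t: "t * t * k = -1" using k by (simp add: power2_eq_square field_simps)
      then have t0: "t \<noteq> 0" by auto
      have "det3 (1 - t * b,0,t) (1 + t * b,0,-t) (0,2,0) \<noteq> 0" using t0 by (simp add: algebra_simps)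
      then show ?thesis
      proof (rule T.change_basis)
        fix N C h
        let ?u = "(1 - t * b,0,t)" and ?v = "(1 + t * b,0,-t)"
        assume H: "poisson3 N C" "poisson_iso scale3 M' B' scale3 N C h" "\<And>x. h x = 0 \<longleftrightarrow> x = 0"
          "h (0,2,0) = (0,0,1)"
          "poisson3.M11 N = h (M' ?u ?u)" "poisson3.M12 N = h (M' ?u ?v)"
          "poisson3.M13 N = h (M' ?u (0,2,0))" "poisson3.M22 N = h (M' ?v ?v)"
          "poisson3.M23 N = h (M' ?v (0,2,0))" "poisson3.M33 N = h (M' (0,2,0) (0,2,0))"
        have h0: "h (0,0,0) = (0,0,0)" using H(3) by (simp add: zero3)
        have "M' ?u ?u = (0,0,0)" "M' ?v ?v = (0,0,0)" "M' ?u ?v = (0,2,0)"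
          "M' ?u (0,2,0) = (0,0,0)" "M' ?v (0,2,0) = (0,0,0)" "M' (0,2,0) (0,2,0) = (0,0,0)"
          using t by (simp add: ex k zero3; algebra)+
        then have "classified scale3 N C" using H h0
          by (intro poisson3.classified_product_e3) (simp_all add: zero3)
        then show ?thesis by (rule classified_trans [OF H(2)])
      qed
    qed
    then show ?thesis by (rule classified_trans [OF T(2)])
  qed
qed

subsection \<open>Lie algebras\<close>

lemma classified_Lie_eigenvector:
  assumes M0: "\<And>x y. M x y = 0" and "y \<noteq> 0" "B x y = y"
  shows "classified scale3 M B"
proof -
  have "a = 0 \<and> b = 0" if r: "scale3 a x + scale3 b y = 0" for a b
  proof -
    have "scale3 b y = 0"
      using arg_cong [OF r, of "B x"] assms by (simp add: B_add B_scale B_self)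
    then have "b = 0" using assms by (simp add: scale3_eq_0)
    moreover have "x \<noteq> 0" using assms by auto
    ultimately show ?thesis using r by (simp add: scale3_eq_0)
  qed
  then obtain z where "det3 x y z \<noteq> 0" using det3_extend2 by metis
  then show ?thesis
  proof (rule change_basis)
    fix M' B' g
    assume T: "poisson3 M' B'" "poisson_iso scale3 M B scale3 M' B' g" "surj g"
      "\<And>x. g x = 0 \<longleftrightarrow> x = 0" "\<And>x y. M' (g x) (g y) = g (M x y)"
      "g y = (0,1,0)" "poisson3.B12 B' = g (B x y)"
    interpret T: poisson3 M' B' by (rule T(1))
    have M: "M' v w = 0" for v w using T(3-5) M0 by (metis surj_def)
    have b12: "T.B12 = (0,1,0)" using T assms by simp
    obtain a b c where b13: "T.B13 = (a, b, c)" by (metis prod_cases3)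
    obtain p q r where b23: "T.B23 = (p, q, r)" by (metis prod_cases3)
    note ex = T.B_expand b12 b13 b23 zero3
    have J: "r = 0" "p * (c + 1) = 0" "a = c * q"
      using T.B_Jacobi [of "(1,0,0)" "(0,1,0)" "(0,0,1)"] by (auto simp: ex algebra_simps)
    note ex = T.B_expand b12 b13 b23 J M model_table
    have "classified scale3 M' B'"
    proof (cases "p = 0")
      case p: False
      \<comment> \<open>This is sl2: \<open>{x,-}\<close> has eigenvalues 1, -1, 0. The new basis is
        \<open>y\<close>, an eigenvector for -1 scaled so that its bracket with \<open>y\<close> is
        \<open>2 x\<close>, and \<open>2 x\<close>.\<close>
      then have c: "c = -1" using J(2) by (simp add: eq_neg_iff_add_eq_0)
      show ?thesis
        by (rule T.classifiedI [of 5 "(0,1,0)" "(2*q/p,-b/p,2/p)" "(2,0,0)"])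
          (use p in \<open>simp_all add: ex c\<close>)
    next
      case p: True
      \<comment> \<open>Now \<open>{y,z} = q y\<close>, so \<open>y\<close> and
        \<open>z + q x\<close> commute. On their span \<open>{x,-}\<close> is triangular with
        diagonal 1, \<open>c\<close> and off-diagonal entry \<open>b\<close>: diagonalisable, unless
        \<open>c = 1\<close> and \<open>b\<close> is nonzero, which gives a Jordan block.\<close>
      show ?thesis
      proof (cases "c = 1")
        case False
        then have "c - 1 \<noteq> 0" by simp
        then show ?thesis
          by (intro T.classifiedI [of 4 "(1,0,0)" "(0,1,0)" "(q,b/(c-1),1)" c])
            (simp_all add: ex p field_simps)
      next
        case c: True
        show ?thesis
        proof (cases "b = 0")
          case True
          then show ?thesis
            by (intro T.classifiedI [of 4 "(1,0,0)" "(0,1,0)" "(q,0,1)" 1])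
              (simp_all add: ex p c)
        next
          case False
          then show ?thesis
            by (intro T.classifiedI [of 3 "(1,0,0)" "(0,b,0)" "(q,0,1)" 1])
              (simp_all add: ex p c)
        qed
      qed
    qed
    then show ?thesis by (rule classified_trans [OF T(2)])
  qed
qed

text \<open>By scaling, no \<open>{x,-}\<close> has a nonzero eigenvalue. If
  \<open>z = {x,y}\<close> is nonzero, it is independent of \<open>x\<close> and \<open>y\<close>,
  as a relation involving \<open>z\<close> would make it an eigenvector of both \<open>{x,-}\<close>
  and \<open>{y,-}\<close>. The absence of nonzero eigenvalues then also kills the brackets with
  \<open>z\<close>.\<close>

lemma classified_Lie_no_eigenvector:
  assumes M0: "\<And>x y. M x y = 0" and no: "\<And>x y. B x y = y \<Longrightarrow> y = 0"
  shows "classified scale3 M B"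
proof (cases "\<exists>x y. B x y \<noteq> 0")
  case False
  then show ?thesis
    by (intro classifiedI [of 1 "(1,0,0)" "(0,1,0)" "(0,0,1)"]) (simp_all add: M0 model_table)
next
  case True
  have ev: "y = 0" if "B x y = scale3 c y" "c \<noteq> 0" for x y c
    using that no [of "scale3 (1/c) x" y] by (cases y) (simp add: B_scale)
  obtain x y where xy: "B x y \<noteq> 0" using True by blast
  let ?z = "B x y"
  have "det3 x y ?z \<noteq> 0"
  proof
    assume "det3 x y ?z = 0"
    then obtain a b c where abc: "(a, b, c) \<noteq> (0, 0, 0)"
      and r: "scale3 a x + scale3 b y + scale3 c ?z = 0" by (rule det3_eq_0_dependent)
    have 1: "scale3 b ?z + scale3 c (B x ?z) = 0"
      using arg_cong [OF r, of "B x"] by (simp add: B_add B_scale B_self)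
    have "scale3 a (- ?z) + scale3 c (B y ?z) = 0"
      using arg_cong [OF r, of "B y"] by (simp add: B_add B_scale B_self B_anti [of y x])
    then have 2: "scale3 (- a) ?z + scale3 c (B y ?z) = 0"
      by (simp add: scale3_def)
    show False
    proof (cases "c = 0")
      case True
      then show ?thesis using 1 2 xy abc by (simp add: scale3_eq_0)
    next
      case False
      have "B x ?z = scale3 (- b / c) ?z" "B y ?z = scale3 (a / c) ?z"
        using scale3_solve [OF 1 False] scale3_solve [OF 2 False] by simp_all
      then have "b = 0" "a = 0" using ev xy False by (metis divide_eq_0_iff neg_equal_0_iff_equal)+
      then show ?thesis using r False xy by (simp add: scale3_eq_0)
    qed
  qed
  then show ?thesis
  proof (rule change_basis)
    fix M' B' g
    assume T: "poisson3 M' B'" "poisson_iso scale3 M B scale3 M' B' g" "surj g"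
      "\<And>c x. g (scale3 c x) = scale3 c (g x)"
      "\<And>x. g x = 0 \<longleftrightarrow> x = 0" "\<And>x y. g (x - y) = g x - g y" "\<And>x y. M' (g x) (g y) = g (M x y)"
      "\<And>x y. B' (g x) (g y) = g (B x y)"
      "g (B x y) = (0,0,1)" "poisson3.B12 B' = g (B x y)"
    interpret T: poisson3 M' B' by (rule T(1))
    have M: "M' v w = 0" for v w using T(3,5,7) M0 by (metis surj_def)
    have ev: "k = 0" if eq: "B' h k = scale3 c k" "c \<noteq> 0" for h k c
    proof -
      obtain h' k' where hk: "h = g h'" "k = g k'" using T(3) by (metis surj_def)
      then have "g (B h' k' - scale3 c k') = 0" using eq T(4,6,8) by simp
      then have "B h' k' = scale3 c k'" using T(5) by simp
      then show ?thesis using ev eq(2) hk T(5) by blast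
    qed
    have b12: "T.B12 = (0,0,1)" using T by simp
    obtain a b c where b13: "T.B13 = (a, b, c)" by (metis prod_cases3)
    obtain p q r where b23: "T.B23 = (p, q, r)" by (metis prod_cases3)
    note ex = T.B_expand b12 b13 b23 zero3
    \<comment> \<open>For a root \<open>l\<close> of \<open>X^2 - c X - b\<close>, the vector
      \<open>(a,b,l)\<close> solves the eigenvalue equation of \<open>{e1,-}\<close>. So both roots
      vanish, and with them \<open>b\<close> and \<open>c\<close>.\<close>
    have bc: "l = 0" if "l * l = c * l + b" for l
      using ev [of "(1,0,0)" "(a,b,l)" l] that by (auto simp: ex algebra_simps)
    obtain l m where lm: "l + m = c" "l * m = - b" by (rule quadratic_split)
    have "b = - (l * m)" using lm by simp
    then have "l = 0" "m = 0" by (auto intro: bc simp: lm(1) [symmetric] algebra_simps)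
    then have b0: "b = 0" "c = 0" using lm by auto
    \<comment> \<open>The same for \<open>{e2,-}\<close>; the signs come from
      \<open>{e2,e1} = -e3\<close>.\<close>
    have pr: "l = 0" if "l * l = r * l - p" for l
      using ev [of "(0,1,0)" "(- p,- q,- l)" l] that by (auto simp: ex algebra_simps)
    obtain l m where lm: "l + m = r" "l * m = p" by (rule quadratic_split)
    have "l = 0" "m = 0" by (auto intro: pr simp: lm [symmetric] algebra_simps)
    then have p0: "p = 0" "r = 0" using lm by auto
    have a0: "a = 0" using ev [of "(0,0,1)" "(1,0,0)" "- a"] by (auto simp: ex b0)
    have q0: "q = 0" using ev [of "(0,0,1)" "(0,1,0)" "- q"] by (auto simp: ex p0)
    have "classified scale3 M' B'"
      by (intro T.classifiedI [of 2 "(1,0,0)" "(0,1,0)" "(0,0,1)"])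
        (simp_all add: T.B_expand b12 b13 b23 b0 p0 a0 q0 M model_table)
    then show ?thesis by (rule classified_trans [OF T(2)])
  qed
qed

lemma classified: "classified scale3 M B"
proof (cases "\<exists>f. M f f = f \<and> f \<noteq> 0")
  case True
  then show ?thesis using classified_idempotent by blast
next
  case False
  then have nil: "M x (M x (M x x)) = 0" for x
    using nilpotent_or_idempotent by metis
  show ?thesis
  proof (cases "\<exists>x. M x (M x x) \<noteq> 0")
    case True
    then show ?thesis using classified_nilpotent_quartic nil by blast
  next
    case cubes: False
    show ?thesis
    proof (cases "\<exists>x y. M x y \<noteq> 0")
      case True
      then show ?thesis using classified_cubes_zero cubes by blast
    next
      case False
      then show ?thesis using classified_Lie_eigenvector classified_Lie_no_eigenvector by blast
    qed
  qed
qed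

end

lemma poisson_algebra_classified:
  fixes sc :: "complex \<Rightarrow> 'a::ab_group_add \<Rightarrow> 'a"
  assumes P: "poisson_algebra sc m b" and "vector_space.dim sc (UNIV :: 'a set) = 3"
  shows "classified sc m b"
proof -
  have "vector_space sc" using P by (simp add: poisson_algebra_def)
  then obtain u v w where "frame sc u v w" using frame_exists assms(2) by blast
  then obtain m' b' g where "poisson_algebra scale3 m' b'" "poisson_iso sc m b scale3 m' b' g"
    using transport [OF P] by metis
  then show ?thesis
    using classified_trans poisson3.classified poisson3.intro by blast
qed

section \<open>Isomorphisms between the models\<close>

lemma model_products:
  "n \<le> 5 \<Longrightarrow> model_mult n \<alpha> (x1,x2,x3) (y1,y2,y3) = (0,0,0)"
  "model_mult 6 \<alpha> (x1,x2,x3) (y1,y2,y3) = (0, x1*y1, x1*y2 + x2*y1)"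
  "model_mult 7 \<alpha> (x1,x2,x3) (y1,y2,y3) = (x1*y1, x2*y2, x3*y3)"
  "model_mult 8 \<alpha> (x1,x2,x3) (y1,y2,y3) = (x1*y1, x2*y2, x2*y3 + x3*y2)"
  "model_mult 9 \<alpha> (x1,x2,x3) (y1,y2,y3) = (x1*y1, x1*y2 + x2*y1, x1*y3 + x3*y1 + x2*y2)"
  "model_mult 10 \<alpha> (x1,x2,x3) (y1,y2,y3) = (x1*y1, x2*y2, 0)"
  "model_mult 11 \<alpha> (x1,x2,x3) (y1,y2,y3) = (x1*y1, x1*y2 + x2*y1, 0)"
  "model_mult 12 \<alpha> (x1,x2,x3) (y1,y2,y3) = (x1*y1, 0, x2*y2)"
  "n \<in> {13, 14, 15} \<Longrightarrow> model_mult n \<alpha> (x1,x2,x3) (y1,y2,y3) = (0, x1*y1, 0)"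
  "model_mult 16 \<alpha> (x1,x2,x3) (y1,y2,y3) = (0, 0, x1*y2 + x2*y1)"
  "n \<in> {17, 18} \<Longrightarrow> model_mult n \<alpha> (x1,x2,x3) (y1,y2,y3) = (x1*y1, x1*y2 + x2*y1, x1*y3 + x3*y1)"
  "n \<in> {19, 20} \<Longrightarrow> model_mult n \<alpha> (x1,x2,x3) (y1,y2,y3) = (x1*y1, 0, 0)"
  by (auto simp: model_simps)

lemma model_brackets:
  "n \<notin> {2,3,4,5,14,15,16,18,20} \<Longrightarrow> model_br n \<alpha> (x1,x2,x3) (y1,y2,y3) = (0,0,0)"
  "model_br 2 \<alpha> (x1,x2,x3) (y1,y2,y3) = (0, 0, x1*y2 - x2*y1)"
  "model_br 3 \<alpha> (x1,x2,x3) (y1,y2,y3) = (0, (x1*y2 - x2*y1) + (x1*y3 - x3*y1), x1*y3 - x3*y1)"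
  "model_br 4 \<alpha> (x1,x2,x3) (y1,y2,y3) = (0, x1*y2 - x2*y1, \<alpha> * (x1*y3 - x3*y1))"
  "model_br 5 \<alpha> (x1,x2,x3) (y1,y2,y3) = (-2 * (x1*y3 - x3*y1), 2 * (x2*y3 - x3*y2), x1*y2 - x2*y1)"
  "model_br 14 \<alpha> (x1,x2,x3) (y1,y2,y3) = (0, 0, x1*y3 - x3*y1)"
  "model_br 15 \<alpha> (x1,x2,x3) (y1,y2,y3) = (0, x1*y3 - x3*y1, 0)"
  "model_br 16 \<alpha> (x1,x2,x3) (y1,y2,y3) = (0, 0, \<alpha> * (x1*y2 - x2*y1))"
  "n \<in> {18, 20} \<Longrightarrow> model_br n \<alpha> (x1,x2,x3) (y1,y2,y3) = (0, x2*y3 - x3*y2, 0)"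
  by (auto simp: model_simps)

lemmas models = model_products model_brackets

lemma index_cases:
  assumes "n \<in> {1..20::nat}"
  shows "n \<in> {1,2,3,4,5,6,7,8,9,10,11,12,13,14,15,16,17,18,19,20}"
  using assms by simp presburger

section \<open>Properties preserved by isomorphisms\<close>

definition has_product :: "(V3 \<Rightarrow> V3 \<Rightarrow> V3) \<Rightarrow> bool" where
  "has_product m \<longleftrightarrow> (\<exists>x y. m x y \<noteq> 0)"

definition has_unit :: "(V3 \<Rightarrow> V3 \<Rightarrow> V3) \<Rightarrow> bool" where
  "has_unit m \<longleftrightarrow> (\<exists>u. \<forall>x. m u x = x)"

text \<open>For the product of a Poisson algebra on \<open>V3\<close> this amounts to a nonzero
  idempotent, by \<open>nilpotent_or_idempotent\<close>, but it is easier to evaluate.\<close>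

definition has_fourth_power :: "(V3 \<Rightarrow> V3 \<Rightarrow> V3) \<Rightarrow> bool" where
  "has_fourth_power m \<longleftrightarrow> (\<exists>x. m x (m x (m x x)) \<noteq> 0)"

definition has_nilpotent_3 :: "(V3 \<Rightarrow> V3 \<Rightarrow> V3) \<Rightarrow> bool" where
  "has_nilpotent_3 m \<longleftrightarrow> (\<exists>x. m x x \<noteq> 0 \<and> m x (m x x) = 0)"

definition has_active_square_zero :: "(V3 \<Rightarrow> V3 \<Rightarrow> V3) \<Rightarrow> bool" where
  "has_active_square_zero m \<longleftrightarrow> (\<exists>x y. m x x = 0 \<and> m x y \<noteq> 0)"

definition has_orthogonal_idempotents :: "(V3 \<Rightarrow> V3 \<Rightarrow> V3) \<Rightarrow> bool" where
  "has_orthogonal_idempotents m \<longleftrightarrow>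
     (\<exists>x y. x \<noteq> 0 \<and> y \<noteq> 0 \<and> m x x = x \<and> m y y = y \<and> m x y = 0)"

definition has_eigenvector :: "(V3 \<Rightarrow> V3 \<Rightarrow> V3) \<Rightarrow> bool" where
  "has_eigenvector b \<longleftrightarrow> (\<exists>x y. y \<noteq> 0 \<and> b x y = y)"

definition not_metabelian :: "(V3 \<Rightarrow> V3 \<Rightarrow> V3) \<Rightarrow> bool" where
  "not_metabelian b \<longleftrightarrow> (\<exists>x y z w. b (b x y) (b z w) \<noteq> 0)"

text \<open>The last condition excludes the eigenvector \<open>x\<close> for \<open>\<gamma> = 0\<close>.\<close>

definition has_eigenpair :: "complex \<Rightarrow> (V3 \<Rightarrow> V3 \<Rightarrow> V3) \<Rightarrow> bool" where
  "has_eigenpair \<gamma> b \<longleftrightarrow> (\<exists>x y z. y \<noteq> 0 \<and> b x y = y \<and> b x z = scale3 \<gamma> z \<and>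
     (\<forall>p q. z \<noteq> scale3 p x + scale3 q y))"

text \<open>Exchanging \<open>x\<close> and \<open>y\<close> changes the sign of \<gamma>, so at
  best its square is determined by the algebra.\<close>

definition has_ratio :: "complex \<Rightarrow> (V3 \<Rightarrow> V3 \<Rightarrow> V3) \<Rightarrow> (V3 \<Rightarrow> V3 \<Rightarrow> V3) \<Rightarrow> bool" where
  "has_ratio \<gamma> m b \<longleftrightarrow> (\<exists>x y. m x x = 0 \<and> m y y = 0 \<and> m x y \<noteq> 0 \<and> b x y = scale3 \<gamma> (m x y))"

lemma iso_invariants:
  assumes iso: "poisson_iso scale3 m b scale3 m' b' f"
  shows "has_product m \<Longrightarrow> has_product m'"
    and "has_product b \<Longrightarrow> has_product b'"
    and "has_unit m \<Longrightarrow> has_unit m'"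
    and "has_fourth_power m \<Longrightarrow> has_fourth_power m'"
    and "has_nilpotent_3 m \<Longrightarrow> has_nilpotent_3 m'"
    and "has_active_square_zero m \<Longrightarrow> has_active_square_zero m'"
    and "has_orthogonal_idempotents m \<Longrightarrow> has_orthogonal_idempotents m'"
    and "has_eigenvector b \<Longrightarrow> has_eigenvector b'"
    and "not_metabelian b \<Longrightarrow> not_metabelian b'"
    and "has_eigenpair \<gamma> b \<Longrightarrow> has_eigenpair \<gamma> b'"
    and "has_ratio \<gamma> m b \<Longrightarrow> has_ratio \<gamma> m' b'"
proof -
  have f: "Vector_Spaces.linear scale3 scale3 f" "bij f"
    and h: "\<And>x y. m' (f x) (f y) = f (m x y)" "\<And>x y. b' (f x) (f y) = f (b x y)"
    using iso by (simp_all only: poisson_iso_def)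
  interpret f: Vector_Spaces.linear scale3 scale3 f by (rule f(1))
  have 0: "f x = 0 \<longleftrightarrow> x = 0" for x using f(2) f.zero by (metis bij_pointE)
  have inj: "f x = f y \<longleftrightarrow> x = y" for x y using f(2) by (metis bij_pointE)
  show "has_product m \<Longrightarrow> has_product m'" "has_product b \<Longrightarrow> has_product b'"
    unfolding has_product_def by (metis h 0)+
  show "has_unit m \<Longrightarrow> has_unit m'"
    unfolding has_unit_def using f(2) by (metis h bij_pointE)
  show "has_fourth_power m \<Longrightarrow> has_fourth_power m'"
    unfolding has_fourth_power_def by (metis h 0)
  show "has_nilpotent_3 m \<Longrightarrow> has_nilpotent_3 m'"
    unfolding has_nilpotent_3_def by (metis h 0)
  show "has_active_square_zero m \<Longrightarrow> has_active_square_zero m'"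
    unfolding has_active_square_zero_def by (metis h 0)
  show "has_orthogonal_idempotents m \<Longrightarrow> has_orthogonal_idempotents m'"
    unfolding has_orthogonal_idempotents_def by (metis h 0)
  show "has_eigenvector b \<Longrightarrow> has_eigenvector b'"
    unfolding has_eigenvector_def by (metis h 0)
  show "not_metabelian b \<Longrightarrow> not_metabelian b'"
    unfolding not_metabelian_def by (metis h 0)
  show "has_eigenpair \<gamma> b'" if "has_eigenpair \<gamma> b"
  proof -
    obtain x y z where xyz: "y \<noteq> 0" "b x y = y" "b x z = scale3 \<gamma> z"
      "\<forall>p q. z \<noteq> scale3 p x + scale3 q y" using \<open>has_eigenpair \<gamma> b\<close> unfolding has_eigenpair_def by blast
    have "\<forall>p q. f z \<noteq> scale3 p (f x) + scale3 q (f y)"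
      using xyz(4) by (simp only: f.add [symmetric] f.scale [symmetric] inj) simp
    then show ?thesis unfolding has_eigenpair_def
      using xyz(1-3) by (intro exI [of _ "f x"] exI [of _ "f y"] exI [of _ "f z"]) (simp add: h 0 f.scale)
  qed
  show "has_ratio \<gamma> m' b'" if "has_ratio \<gamma> m b"
  proof -
    obtain x y where "m x x = 0" "m y y = 0" "m x y \<noteq> 0" "b x y = scale3 \<gamma> (m x y)"
      using \<open>has_ratio \<gamma> m b\<close> unfolding has_ratio_def by blast
    then show ?thesis unfolding has_ratio_def
      by (intro exI [of _ "f x"] exI [of _ "f y"]) (simp add: h 0 f.scale)
  qed
qed

lemma iso_invariants_iff:
  assumes "poisson_iso scale3 m b scale3 m' b' f"
  shows "has_product m \<longleftrightarrow> has_product m'"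
    and "has_product b \<longleftrightarrow> has_product b'"
    and "has_unit m \<longleftrightarrow> has_unit m'"
    and "has_fourth_power m \<longleftrightarrow> has_fourth_power m'"
    and "has_nilpotent_3 m \<longleftrightarrow> has_nilpotent_3 m'"
    and "has_active_square_zero m \<longleftrightarrow> has_active_square_zero m'"
    and "has_orthogonal_idempotents m \<longleftrightarrow> has_orthogonal_idempotents m'"
    and "has_eigenvector b \<longleftrightarrow> has_eigenvector b'"
    and "not_metabelian b \<longleftrightarrow> not_metabelian b'"
    and "has_eigenpair \<gamma> b \<longleftrightarrow> has_eigenpair \<gamma> b'"
    and "has_ratio \<gamma> m b \<longleftrightarrow> has_ratio \<gamma> m' b'"
  by (rule iffI; erule iso_invariants [OF assms] iso_invariants [OF poisson_iso_sym [OF assms]])+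

section \<open>Evaluation of these properties on the models\<close>

lemma has_product_mult:
  assumes "n \<in> {1..20}"
  shows "has_product (model_mult n \<alpha>) \<longleftrightarrow> 6 \<le> n"
proof
  show "6 \<le> n" if "has_product (model_mult n \<alpha>)"
    using that by (cases "n \<le> 5") (auto simp: has_product_def models zero3)
  show "has_product (model_mult n \<alpha>)" if "6 \<le> n"
  proof -
    \<comment> \<open>A sum of two basis vectors, since for index 16 every basis vector squares to
      zero.\<close>
    have "model_mult n \<alpha> (1,1,0) (1,1,0) \<noteq> 0"
      using index_cases [OF assms] that by (auto simp: models zero3)
    then show ?thesis unfolding has_product_def by blast
  qed
qed

lemma has_product_br:
  assumes "n \<in> {1..20}"
  shows "has_product (model_br n \<alpha>) \<longleftrightarrow> n \<in> {2,3,4,5,14,15,18,20} \<or> n = 16 \<and> \<alpha> \<noteq> 0"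
proof
  show "n \<in> {2,3,4,5,14,15,18,20} \<or> n = 16 \<and> \<alpha> \<noteq> 0" if "has_product (model_br n \<alpha>)"
    using that by (cases "n \<in> {2,3,4,5,14,15,16,18,20}") (auto simp: has_product_def models zero3)
  show "has_product (model_br n \<alpha>)" if "n \<in> {2,3,4,5,14,15,18,20} \<or> n = 16 \<and> \<alpha> \<noteq> 0"
  proof -
    \<comment> \<open>All three minors of this pair are nonzero, so it detects every bracket of the
      tables.\<close>
    have "model_br n \<alpha> (1,0,1) (0,1,1) \<noteq> 0"
      using that by (auto simp: models zero3)
    then show ?thesis unfolding has_product_def by blast
  qed
qed

lemma has_unit_mult:
  assumes "n \<in> {1..20}"
  shows "has_unit (model_mult n \<alpha>) \<longleftrightarrow> n \<in> {7,8,9,17,18}"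
proof
  show "n \<in> {7,8,9,17,18}" if unit: "has_unit (model_mult n \<alpha>)"
  proof -
    \<comment> \<open>One test vector is enough: for the other indices, some coordinate of its
      products is always 0.\<close>
    obtain u where "model_mult n \<alpha> u (1,1,1) = (1,1,1)" using unit unfolding has_unit_def by blast
    then show ?thesis using index_cases [OF assms] by (cases u) (auto simp: models)
  qed
  have "has_unit (model_mult 7 \<alpha>)" unfolding has_unit_def
    by (rule exI [of _ "(1,1,1)"]) (simp add: models)
  moreover have "has_unit (model_mult 8 \<alpha>)" unfolding has_unit_def
    by (rule exI [of _ "(1,1,0)"]) (simp add: models)
  moreover have "has_unit (model_mult k \<alpha>)" if "k \<in> {9,17,18}" for k unfolding has_unit_def
    by (rule exI [of _ "(1,0,0)"]) (use that in \<open>auto simp: models\<close>)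
  ultimately show "has_unit (model_mult n \<alpha>)" if "n \<in> {7,8,9,17,18}" using that by blast
qed

lemma has_fourth_power_mult:
  assumes "n \<in> {1..20}"
  shows "has_fourth_power (model_mult n \<alpha>) \<longleftrightarrow> n \<in> {7,8,9,10,11,12,17,18,19,20}"
proof
  show "n \<in> {7,8,9,10,11,12,17,18,19,20}" if "has_fourth_power (model_mult n \<alpha>)"
    using that index_cases [OF assms] unfolding has_fourth_power_def
    by (auto simp: models zero3)
  show "has_fourth_power (model_mult n \<alpha>)" if "n \<in> {7,8,9,10,11,12,17,18,19,20}"
    unfolding has_fourth_power_def
    by (rule exI [of _ "(1,0,0)"]) (use that in \<open>auto simp: models zero3\<close>)
qed

lemma has_nilpotent_3_mult:
  assumes "n \<in> {1..20}"
  shows "has_nilpotent_3 (model_mult n \<alpha>) \<longleftrightarrow> n \<in> {9,12,13,14,15,16}"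
proof
  show "n \<in> {9,12,13,14,15,16}" if "has_nilpotent_3 (model_mult n \<alpha>)"
    using that index_cases [OF assms] unfolding has_nilpotent_3_def
    by (auto simp: models zero3)
  have "has_nilpotent_3 (model_mult k \<alpha>)" if "k \<in> {9,12}" for k unfolding has_nilpotent_3_def
    by (rule exI [of _ "(0,1,0)"]) (use that in \<open>auto simp: models zero3\<close>)
  moreover have "has_nilpotent_3 (model_mult k \<alpha>)" if "k \<in> {13,14,15,16}" for k
    unfolding has_nilpotent_3_def
    by (rule exI [of _ "(1,1,0)"]) (use that in \<open>auto simp: models zero3\<close>)
  ultimately show "has_nilpotent_3 (model_mult n \<alpha>)" if "n \<in> {9,12,13,14,15,16}"
    using that by blast
qed

lemma has_active_square_zero_mult:
  assumes "n \<in> {1..20}"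
  shows "has_active_square_zero (model_mult n \<alpha>) \<longleftrightarrow> n \<in> {6,8,9,11,16,17,18}"
proof
  show "n \<in> {6,8,9,11,16,17,18}" if "has_active_square_zero (model_mult n \<alpha>)"
    using that index_cases [OF assms] unfolding has_active_square_zero_def
    by (auto simp: models zero3)
  have "has_active_square_zero (model_mult k \<alpha>)" if "k \<in> {8,9}" for k
    unfolding has_active_square_zero_def
    by (rule exI [of _ "(0,0,1)"], rule exI [of _ "(1,1,0)"]) (use that in \<open>auto simp: models zero3\<close>)
  moreover have "has_active_square_zero (model_mult k \<alpha>)" if "k \<in> {6,11,16,17,18}" for k
    unfolding has_active_square_zero_def
    by (rule exI [of _ "(0,1,0)"], rule exI [of _ "(1,0,0)"]) (use that in \<open>auto simp: models zero3\<close>)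
  ultimately show "has_active_square_zero (model_mult n \<alpha>)" if "n \<in> {6,8,9,11,16,17,18}"
    using that by blast
qed

lemma has_orthogonal_idempotents_mult:
  assumes "n \<in> {1..20}"
  shows "has_orthogonal_idempotents (model_mult n \<alpha>) \<longleftrightarrow> n \<in> {7,8,10}"
proof
  show "n \<in> {7,8,10}" if "has_orthogonal_idempotents (model_mult n \<alpha>)"
    using that index_cases [OF assms] unfolding has_orthogonal_idempotents_def
    by (auto simp: models zero3)
  show "has_orthogonal_idempotents (model_mult n \<alpha>)" if "n \<in> {7,8,10}"
    unfolding has_orthogonal_idempotents_def
    by (rule exI [of _ "(1,0,0)"], rule exI [of _ "(0,1,0)"]) (use that in \<open>auto simp: models zero3\<close>)
qed

lemma has_eigenvector_br:
  assumes "n \<in> {1..20}"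
  shows "has_eigenvector (model_br n \<alpha>) \<longleftrightarrow> n \<in> {3,4,5,14,18,20}"
proof
  show "n \<in> {3,4,5,14,18,20}" if "has_eigenvector (model_br n \<alpha>)"
    using that index_cases [OF assms] unfolding has_eigenvector_def
    by (auto simp: models zero3)
  have "has_eigenvector (model_br k \<alpha>)" if "k \<in> {3,4}" for k unfolding has_eigenvector_def
    by (rule exI [of _ "(1,0,0)"], rule exI [of _ "(0,1,0)"]) (use that in \<open>auto simp: models zero3\<close>)
  moreover have "has_eigenvector (model_br 5 \<alpha>)" unfolding has_eigenvector_def
    by (rule exI [of _ "(0,0,1/2)"], rule exI [of _ "(1,0,0)"]) (simp add: models zero3)
  moreover have "has_eigenvector (model_br 14 \<alpha>)" unfolding has_eigenvector_def
    by (rule exI [of _ "(1,0,0)"], rule exI [of _ "(0,0,1)"]) (simp add: models zero3)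
  moreover have "has_eigenvector (model_br k \<alpha>)" if "k \<in> {18,20}" for k unfolding has_eigenvector_def
    by (rule exI [of _ "(0,0,-1)"], rule exI [of _ "(0,1,0)"]) (use that in \<open>auto simp: models zero3\<close>)
  ultimately show "has_eigenvector (model_br n \<alpha>)" if "n \<in> {3,4,5,14,18,20}"
    using that by blast
qed

lemma not_metabelian_br:
  assumes "n \<in> {1..20}"
  shows "not_metabelian (model_br n \<alpha>) \<longleftrightarrow> n = 5"
proof
  show "n = 5" if "not_metabelian (model_br n \<alpha>)"
    using that index_cases [OF assms] unfolding not_metabelian_def
    by (auto simp: models zero3)
  have "model_br 5 \<alpha> (model_br 5 \<alpha> (1,0,0) (0,1,0)) (model_br 5 \<alpha> (1,0,0) (0,0,1)) \<noteq> 0"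
    by (simp add: models zero3)
  then show "not_metabelian (model_br n \<alpha>)" if "n = 5"
    unfolding not_metabelian_def that by blast
qed

lemma has_eigenpair_model_4: "has_eigenpair \<alpha> (model_br 4 \<alpha>)"
  unfolding has_eigenpair_def
  by (rule exI [of _ "(1,0,0)"], rule exI [of _ "(0,1,0)"], rule exI [of _ "(0,0,1)"])
    (simp add: models zero3)

lemma has_ratio_model_16: "has_ratio \<alpha> (model_mult 16 \<alpha>) (model_br 16 \<alpha>)"
  unfolding has_ratio_def
  by (rule exI [of _ "(1,0,0)"], rule exI [of _ "(0,1,0)"]) (simp add: models zero3)

text \<open>Square zero means \<open>x1 x2 = 0\<close>. Then \<open>x1 y2 - x2 y1\<close> and
  \<open>x1 y2 + x2 y1\<close> have equal squares, as these differ by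
  \<open>4 x1 x2 y1 y2\<close>.\<close>

lemma has_ratio_16_imp:
  assumes "has_ratio \<gamma> (model_mult 16 \<beta>) (model_br 16 \<beta>)"
  shows "\<gamma>\<^sup>2 = \<beta>\<^sup>2"
proof -
  obtain x1 x2 y1 y2 where xy: "x1 * x2 = 0" "x1 * y2 + x2 * y1 \<noteq> 0"
    "\<beta> * (x1 * y2 - x2 * y1) = \<gamma> * (x1 * y2 + x2 * y1)"
    using assms unfolding has_ratio_def by (auto simp: models zero3)
  have "\<gamma>\<^sup>2 * (x1 * y2 + x2 * y1)\<^sup>2 = (\<beta> * (x1 * y2 - x2 * y1))\<^sup>2"
    by (simp add: xy(3) power_mult_distrib)
  also have "\<dots> = \<beta>\<^sup>2 * ((x1 * y2 + x2 * y1)\<^sup>2 - 4 * (x1 * x2) * (y1 * y2))"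
    by (simp add: power2_eq_square algebra_simps)
  finally show ?thesis using xy by simp
qed

text \<open>Here \<open>x1 = 1\<close>, and on the span of \<open>e2\<close> and \<open>e3\<close>
  the map \<open>{x,-}\<close> is a Jordan block for 1, whose eigenvectors are the multiples of
  \<open>y\<close>. So \<open>z\<close> falls into the span of \<open>x\<close> and
  \<open>y\<close>.\<close>

lemma has_eigenpair_3: "\<not> has_eigenpair \<gamma> (model_br 3 \<beta>)"
proof
  assume "has_eigenpair \<gamma> (model_br 3 \<beta>)"
  then obtain x1 x2 x3 y1 y2 y3 z1 z2 z3
    where y: "(y1, y2, y3) \<noteq> 0" "model_br 3 \<beta> (x1,x2,x3) (y1,y2,y3) = (y1,y2,y3)"
      and z: "model_br 3 \<beta> (x1,x2,x3) (z1,z2,z3) = scale3 \<gamma> (z1,z2,z3)"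
      and ind: "\<And>p q. (z1,z2,z3) \<noteq> scale3 p (x1,x2,x3) + scale3 q (y1,y2,y3)"
    unfolding has_eigenpair_def by (metis prod_cases3)
  have y': "y1 = 0" "y3 = 0" "x1 = 1" "y2 \<noteq> 0" using y by (auto simp: models zero3)
  have z': "\<gamma> = 0 \<or> z1 = 0" "z3 - x3 * z1 = \<gamma> * z3" "z2 - x2 * z1 + (z3 - x3 * z1) = \<gamma> * z2"
    using z by (auto simp: models y')
  then have "z3 = z1 * x3" by auto
  then show False using ind [of z1 "(z2 - z1 * x2) / y2"] y' by simp
qed

text \<open>On the span of \<open>e2\<close> and \<open>e3\<close>, \<open>{x,-}\<close> is diagonal
  with entries \<open>x1\<close> and \<open>\<beta> * x1\<close>. The vector \<open>y\<close> makes
  one of them 1, and \<open>z\<close>, being independent of \<open>x\<close> and \<open>y\<close>,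
  has the other as eigenvalue.\<close>

lemma has_eigenpair_4_imp:
  assumes "has_eigenpair \<gamma> (model_br 4 \<beta>)"
  shows "\<gamma> = \<beta> \<or> \<beta> \<noteq> 0 \<and> \<gamma> = 1 / \<beta>"
proof -
  obtain x1 x2 x3 y1 y2 y3 z1 z2 z3
    where y: "(y1, y2, y3) \<noteq> 0" "model_br 4 \<beta> (x1,x2,x3) (y1,y2,y3) = (y1,y2,y3)"
      and z: "model_br 4 \<beta> (x1,x2,x3) (z1,z2,z3) = scale3 \<gamma> (z1,z2,z3)"
      and ind: "\<And>p q. (z1,z2,z3) \<noteq> scale3 p (x1,x2,x3) + scale3 q (y1,y2,y3)"
    using assms unfolding has_eigenpair_def by (metis prod_cases3)
  have y': "y1 = 0" "x1 * y2 = y2" "\<beta> * (x1 * y3) = y3" "y2 \<noteq> 0 \<or> y3 \<noteq> 0"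
    using y by (auto simp: models zero3)
  then have x1: "x1 \<noteq> 0" by auto
  \<comment> \<open>\<open>(0,u,v)\<close>, divided by \<open>x1\<close>, is the part of
    \<open>z\<close> left after removing its multiple of \<open>x\<close>; independence of
    \<open>z\<close> means that it is not a multiple of \<open>y\<close>.\<close>
  define u where "u = x1 * z2 - x2 * z1"
  define v where "v = x1 * z3 - x3 * z1"
  have z': "\<gamma> = 0 \<or> z1 = 0" "u = \<gamma> * z2" "\<beta> * v = \<gamma> * z3"
    using z by (auto simp: models u_def v_def)
  have "u * y3 \<noteq> v * y2"
  proof
    assume uv: "u * y3 = v * y2"
    have "z2 = z1 / x1 * x2 + u / x1" "z3 = z1 / x1 * x3 + v / x1" "z1 = z1 / x1 * x1"
      using x1 by (simp_all add: u_def v_def field_simps)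
    moreover have "\<exists>q. u / x1 = q * y2 \<and> v / x1 = q * y3"
    proof (cases "y2 = 0")
      case True
      then show ?thesis using uv y' x1 by (intro exI [of _ "v / (x1 * y3)"]) auto
    next
      case False
      then show ?thesis using uv x1 by (intro exI [of _ "u / (x1 * y2)"]) (auto simp: field_simps)
    qed
    ultimately show False using ind [of "z1 / x1"] y' by auto
  qed
  then have "\<gamma> = \<beta> \<or> \<beta> * \<gamma> = 1"
    using y' z' x1 unfolding u_def v_def by (cases "y2 = 0"; cases "y3 = 0"; auto simp: field_simps)
  then show ?thesis by (metis mult_zero_left nonzero_mult_div_cancel_left zero_neq_one)
qed

text \<open>The value 3 stands for both indices 3 and 4.\<close>

definition decode :: "bool \<Rightarrow> bool \<Rightarrow> bool \<Rightarrow> bool \<Rightarrow> bool \<Rightarrow> bool \<Rightarrow> bool \<Rightarrow> bool \<Rightarrow> bool \<Rightarrow> nat" where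
  "decode product bracket unit power4 nil3 square0 orth eigen nonmetab =
    (if \<not> product then if nonmetab then 5 else if eigen then 3 else if bracket then 2 else 1
     else if unit then if orth then if square0 then 8 else 7
       else if nil3 then 9 else if bracket then 18 else 17
     else if power4 then if orth then 10 else if square0 then 11 else if nil3 then 12
       else if bracket then 20 else 19
     else if square0 then if nil3 then 16 else 6
     else if eigen then 14 else if bracket then 15 else 13)"

text \<open>\<open>a\<close> stands for a nonzero parameter; index 16 is recognised from its product
  alone, so both truth values give the same answer.\<close>

lemma decode_index:
  assumes "n \<in> {1..20}"
  shows "decode (6 \<le> n) (n \<in> {2,3,4,5,14,15,18,20} \<or> n = 16 \<and> a) (n \<in> {7,8,9,17,18})
     (n \<in> {7,8,9,10,11,12,17,18,19,20}) (n \<in> {9,12,13,14,15,16}) (n \<in> {6,8,9,11,16,17,18})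
     (n \<in> {7,8,10}) (n \<in> {3,4,5,14,18,20}) (n = 5) = (if n = 4 then 3 else n)"
  using index_cases [OF assms] unfolding insert_iff empty_iff
  by (elim disjE) (simp_all add: decode_def)

lemma iso_imp_listed_equiv:
  assumes iso: "poisson_iso scale3 (model_mult n \<alpha>) (model_br n \<alpha>) scale3 (model_mult m \<beta>) (model_br m \<beta>) f"
    and nm: "n \<in> {1..20}" "m \<in> {1..20}"
  shows "listed_equiv n \<alpha> m \<beta>"
proof -
  note iff = iso_invariants_iff [OF iso]
  have eqs: "6 \<le> n \<longleftrightarrow> 6 \<le> m"
    "n \<in> {2,3,4,5,14,15,18,20} \<or> n = 16 \<and> \<alpha> \<noteq> 0 \<longleftrightarrow> m \<in> {2,3,4,5,14,15,18,20} \<or> m = 16 \<and> \<beta> \<noteq> 0"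
    "n \<in> {7,8,9,17,18} \<longleftrightarrow> m \<in> {7,8,9,17,18}"
    "n \<in> {7,8,9,10,11,12,17,18,19,20} \<longleftrightarrow> m \<in> {7,8,9,10,11,12,17,18,19,20}"
    "n \<in> {9,12,13,14,15,16} \<longleftrightarrow> m \<in> {9,12,13,14,15,16}"
    "n \<in> {6,8,9,11,16,17,18} \<longleftrightarrow> m \<in> {6,8,9,11,16,17,18}"
    "n \<in> {7,8,10} \<longleftrightarrow> m \<in> {7,8,10}"
    "n \<in> {3,4,5,14,18,20} \<longleftrightarrow> m \<in> {3,4,5,14,18,20}"
    "n = 5 \<longleftrightarrow> m = 5"
    using iff(1-9)
    unfolding has_product_mult [OF nm(1)] has_product_mult [OF nm(2)]
      has_product_br [OF nm(1)] has_product_br [OF nm(2)] has_unit_mult [OF nm(1)]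
      has_unit_mult [OF nm(2)] has_fourth_power_mult [OF nm(1)] has_fourth_power_mult [OF nm(2)]
      has_nilpotent_3_mult [OF nm(1)] has_nilpotent_3_mult [OF nm(2)]
      has_active_square_zero_mult [OF nm(1)] has_active_square_zero_mult [OF nm(2)]
      has_orthogonal_idempotents_mult [OF nm(1)] has_orthogonal_idempotents_mult [OF nm(2)]
      has_eigenvector_br [OF nm(1)] has_eigenvector_br [OF nm(2)]
      not_metabelian_br [OF nm(1)] not_metabelian_br [OF nm(2)]
    by - assumption+
  \<comment> \<open>Both indices decode to the same value, and only 3 and 4 share one.\<close>
  have "n = m \<or> {n, m} = {3, 4}"
    using decode_index [OF nm(1), of "\<alpha> \<noteq> 0"] decode_index [OF nm(2), of "\<beta> \<noteq> 0"]
    unfolding eqs by (auto split: if_splits)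
  moreover have "\<not> (n = 4 \<and> m = 3)"
    using iff(10) has_eigenpair_model_4 has_eigenpair_3 by blast
  moreover have "\<not> (n = 3 \<and> m = 4)"
    using iff(10) has_eigenpair_model_4 has_eigenpair_3 by blast
  ultimately have [simp]: "m = n" by (auto simp: doubleton_eq_iff)
  have "\<alpha> = \<beta> \<or> \<alpha> \<noteq> 0 \<and> \<beta> \<noteq> 0 \<and> \<alpha> = 1 / \<beta>" if "n = 4"
    using iff(10) [of \<alpha>] has_eigenpair_model_4 [of \<alpha>] has_eigenpair_4_imp [of \<alpha> \<beta>] that by auto
  moreover have "\<alpha>\<^sup>2 = \<beta>\<^sup>2" if "n = 16"
    using iff(11) [of \<alpha>] has_ratio_model_16 [of \<alpha>] has_ratio_16_imp [of \<alpha> \<beta>] that by auto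
  ultimately show ?thesis unfolding listed_equiv_def by auto
qed

section \<open>Explicit isomorphisms inside the two families\<close>

lemma linear_scale3I:
  assumes "\<And>x y. f (x + y) = f x + f y" "\<And>c x. f (scale3 c x) = scale3 c (f x)"
  shows "Vector_Spaces.linear scale3 scale3 f"
  using vector_space_scale3 assms
  by (simp add: linear_iff_module_hom module_hom_iff vector_space_def module_def linear_def)

lemma iso_refl: "poisson_iso scale3 m b scale3 m b (\<lambda>x. x)"
  by (simp add: poisson_iso_def linear_scale3I bij_id [unfolded id_def])

lemma listed_equiv_imp_iso:
  assumes "listed_equiv n \<alpha> m \<beta>"
  shows "\<exists>f. poisson_iso scale3 (model_mult n \<alpha>) (model_br n \<alpha>) scale3 (model_mult m \<beta>) (model_br m \<beta>) f"
proof -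
  have [simp]: "m = n" using assms by (simp add: listed_equiv_def)
  consider "n \<notin> {4,16}" | "\<alpha> = \<beta>" | "n = 4" "\<alpha> \<noteq> 0" "\<beta> \<noteq> 0" "\<alpha> = 1 / \<beta>" | "n = 16" "\<alpha> = - \<beta>"
    using assms by (auto simp: listed_equiv_def power2_eq_iff)
  then show ?thesis
  proof cases
    case 1
    then have "mult_list n \<alpha> = mult_list n \<beta>" "br_list n \<alpha> = br_list n \<beta>"
      by (auto simp: mult_list_def br_list_def)
    then have "mult_sc n \<alpha> i j = mult_sc n \<beta> i j" "br_sc n \<alpha> i j = br_sc n \<beta> i j" for i j
      by (simp_all only: mult_sc_def br_sc_def)
    then have "model_mult n \<alpha> = model_mult n \<beta>" "model_br n \<alpha> = model_br n \<beta>"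
      by (simp_all only: model_mult_def model_br_def fun_eq_iff) simp_all
    then show ?thesis using iso_refl by auto
  next
    case 2
    then show ?thesis using iso_refl by auto
  next
    case 3
    \<comment> \<open>Replacing \<open>e1\<close> by its multiple with \<alpha> turns the
      eigenvalues 1, \<beta> of \<open>{e1,-}\<close> into \<alpha>, 1, and the swap of the last two
      coordinates restores their order.\<close>
    let ?f = "\<lambda>(x, y, z). (\<alpha> * x, z, y) :: V3" and ?g = "\<lambda>(x, y, z). (\<beta> * x, z, y) :: V3"
    have "bij ?f" by (rule o_bij [of ?g]) (use 3 in \<open>auto simp: fun_eq_iff\<close>)
    moreover have "Vector_Spaces.linear scale3 scale3 ?f"
      by (rule linear_scale3I) (auto simp: algebra_simps)
    moreover have "?f (model_mult n \<alpha> x y) = model_mult m \<beta> (?f x) (?f y)"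
      "?f (model_br n \<alpha> x y) = model_br m \<beta> (?f x) (?f y)" for x y
      by (cases x; cases y; use 3 in \<open>simp add: models field_simps\<close>)+
    ultimately show ?thesis unfolding poisson_iso_def by blast
  next
    case 4
    \<comment> \<open>Exchanging \<open>e1\<close> and \<open>e2\<close> preserves the symmetric
      product and reverses the sign of the bracket.\<close>
    let ?f = "\<lambda>(x, y, z). (y, x, z) :: V3"
    have "bij ?f" by (rule o_bij [of ?f]) (auto simp: fun_eq_iff)
    moreover have "Vector_Spaces.linear scale3 scale3 ?f"
      by (rule linear_scale3I) (auto simp: algebra_simps)
    moreover have "?f (model_mult n \<alpha> x y) = model_mult m \<beta> (?f x) (?f y)"
      "?f (model_br n \<alpha> x y) = model_br m \<beta> (?f x) (?f y)" for x y
      by (cases x; cases y; use 4 in \<open>simp add: models algebra_simps\<close>)+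
    ultimately show ?thesis unfolding poisson_iso_def by blast
  qed
qed

theorem theorem2p3:
  fixes sc :: "complex \<Rightarrow> 'a::ab_group_add \<Rightarrow> 'a"
    and mult br :: "'a \<Rightarrow> 'a \<Rightarrow> 'a"
  assumes "poisson_algebra sc mult br"
    and "vector_space.dim sc (UNIV :: 'a set) = 3"
  shows "(\<exists>n \<alpha> f. n \<in> {1..20} \<and>
            poisson_iso sc mult br scale3 (model_mult n \<alpha>) (model_br n \<alpha>) f)
       \<and> (\<forall>n m \<alpha> \<beta>. n \<in> {1..20} \<longrightarrow> m \<in> {1..20} \<longrightarrow>
            ((\<exists>f. poisson_iso scale3 (model_mult n \<alpha>) (model_br n \<alpha>)
                               scale3 (model_mult m \<beta>) (model_br m \<beta>) f)
             \<longleftrightarrow> listed_equiv n \<alpha> m \<beta>))"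
  using poisson_algebra_classified [OF assms] iso_imp_listed_equiv listed_equiv_imp_iso
  unfolding classified_def by blast

end
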